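(* Let $\mathcal{V}$ be a nondistributive variety of lattices and let $\mathbf{F}$ be a free bounded lattice on at least $\aleph_1$ generators within $\mathcal{V}$. Then $\mathbf{F}^\natural$ is not a CPCP-retract. Consequently, $\mathbf{F}$ has no CPCP-extension.
   Context: A variety of lattices is nondistributive if it contains a nondistributive lattice. A free bounded lattice within $\mathcal{V}$ is a free object in the class of bounded lattices whose lattice reduct belongs to $\mathcal{V}$, with respect to $0,1$-preserving lattice homomorphisms. For a $(\vee,0)$-semilattice $S$, an $S$-valued distance on a set $A$ is a map $\delta\colon A\times A\to S$ with $\delta(x,x)=0$, $\delta(x,y)=\delta(y,x)$, $\delta(x,z)\le\delta(x,y)\vee\delta(y,z)$. A *semilattice-metric space* is a triple $\mathbf{A}=(A,\delta_{\mathbf{A}},\tilde{A})$ with $\tilde{A}$ a $(\vee,0)$-semilattice and $\delta_{\mathbf{A}}$ an $\tilde{A}$-valued distance on the set $A$. A morphism $\mathbf{A}\to\mathbf{B}$ is a pair $(f,\tilde{f})$, with $f\colon A\to B$ a map, $\tilde{f}\colon\tilde{A}\to\tilde{B}$ a $(\vee,0)$-homomorphism, and $\delta_{\mathbf{B}}(f(x),f(y))=\tilde{f}(\delta_{\mathbf{A}}(x,y))$ for all $x,y\in A$. It is a *double arrow*, written $\Rightarrow$, if $f$ is surjective. A *semilattice-metric cover* is a quadruple $\mathbf{B}=(B^*,B,\delta_{\mathbf{B}},\tilde{B})$ with $(B,\delta_{\mathbf{B}},\tilde{B})$ a semilattice-metric space, $B^*\subseteq B$, and such that for all $x,y,z\in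 B^*$ there is $t\in B$ with $\delta_{\mathbf{B}}(x,t)\le\delta_{\mathbf{B}}(y,z)$ and $\delta_{\mathbf{B}}(t,z)\le\delta_{\mathbf{B}}(x,y)$. Set $\mathbf{B}^\flat=(B^*,\delta_{\mathbf{B}}|_{B^*\times B^*},\tilde{B})$. A semilattice-metric space $\mathbf{A}$ is a *CPCP-retract* if there are a semilattice-metric cover $\mathbf{B}$ and a double arrow $\mathbf{B}^\flat\Rightarrow\mathbf{A}$. An *algebra* is a structure (nonempty universe) on a language without relation symbols. For an algebra $\mathbf{A}$ and $x,y\in A$, $\|x=y\|_{\mathbf{A}}$ is the congruence of $\mathbf{A}$ generated by $(x,y)$, and $\mathbf{A}^\natural=(A,\delta_{\mathbf{A}},\mathrm{Con_c}\,\mathbf{A})$ with $\delta_{\mathbf{A}}(x,y)=\|x=y\|_{\mathbf{A}}$, where $\mathrm{Con_c}\,\mathbf{A}$ is the $(\vee,0)$-semilattice of compact congruences of $\mathbf{A}$. An algebra $\mathbf{B}$ is a *CP-extension* of $\mathbf{A}$ if $A\subseteq B$, the language of $\mathbf{A}$ is contained in that of $\mathbf{B}$, the inclusion map is a homomorphism with respect to the language of $\mathbf{A}$, and every congruence of $\mathbf{A}$ extends to a unique congruence of $\mathbf{B}$ (the map sending a congruence of $\mathbf{A}$ to the congruence of $\mathbf{B}$ it generates is an isomorphism $\mathrm{Con}\,\mathbf{A}\to\mathrm{Con}\,\mathbf{B}$). It is a *CPCP-extension* if moreover for all $x,y,z\in A$ there is $t\in B$ with $(x,t)\in\|y=z\|_{\mathbf{B}}$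 and $(t,z)\in\|x=y\|_{\mathbf{B}}$. *)

theory Defs
  imports Main "HOL-Algebra.Complete_Lattice"
begin

unbundle cardinal_syntax

section \<open>Varieties of lattices\<close>

datatype lat_term = LVar nat | LJoin lat_term lat_term | LMeet lat_term lat_term

primrec lat_eval :: "('a, 'c) gorder_scheme \<Rightarrow> (nat \<Rightarrow> 'a) \<Rightarrow> lat_term \<Rightarrow> 'a" where
  "lat_eval L v (LVar n) = v n"
| "lat_eval L v (LJoin s t) = lat_eval L v s \<squnion>\<^bsub>L\<^esub> lat_eval L v t"
| "lat_eval L v (LMeet s t) = lat_eval L v s \<sqinter>\<^bsub>L\<^esub> lat_eval L v t"

text \<open>A variety of lattices is given by a set \<open>E\<close> of lattice identities. It may be any set, and
  membership makes sense for lattices over every carrier type.\<close>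

definition in_variety :: "(lat_term \<times> lat_term) set \<Rightarrow> ('a, 'c) gorder_scheme \<Rightarrow> bool" where
  "in_variety E L \<longleftrightarrow> lattice L \<and>
     (\<forall>(s, t)\<in>E. \<forall>v. range v \<subseteq> carrier L \<longrightarrow> lat_eval L v s = lat_eval L v t)"

definition lat_distributive :: "('a, 'c) gorder_scheme \<Rightarrow> bool" where
  "lat_distributive L \<longleftrightarrow> (\<forall>x\<in>carrier L. \<forall>y\<in>carrier L. \<forall>z\<in>carrier L.
     x \<sqinter>\<^bsub>L\<^esub> (y \<squnion>\<^bsub>L\<^esub> z) = (x \<sqinter>\<^bsub>L\<^esub> y) \<squnion>\<^bsub>L\<^esub> (x \<sqinter>\<^bsub>L\<^esub> z))"

text \<open>The type argument is the type in which the nondistributive member lives. As a hypothesis with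
  a free type variable it says that there is such a member over some type.\<close>

definition nondistributive_variety :: "'n itself \<Rightarrow> (lat_term \<times> lat_term) set \<Rightarrow> bool" where
  "nondistributive_variety _ E \<longleftrightarrow> (\<exists>N :: 'n gorder. in_variety E N \<and> \<not> lat_distributive N)"

section \<open>Free bounded lattices\<close>

definition bl_hom ::
    "('a, 'c) gorder_scheme \<Rightarrow> ('b, 'd) gorder_scheme \<Rightarrow> ('a \<Rightarrow> 'b) set" where
  "bl_hom L M = {h \<in> carrier L \<rightarrow>\<^sub>E carrier M.
     (\<forall>x\<in>carrier L. \<forall>y\<in>carrier L.
        h (x \<squnion>\<^bsub>L\<^esub> y) = h x \<squnion>\<^bsub>M\<^esub> h y \<and> h (x \<sqinter>\<^bsub>L\<^esub> y) = h x \<sqinter>\<^bsub>M\<^esub> h y) \<and>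
     h \<bottom>\<^bsub>L\<^esub> = \<bottom>\<^bsub>M\<^esub> \<and> h \<top>\<^bsub>L\<^esub> = \<top>\<^bsub>M\<^esub>}"

text \<open>The test lattices range over the type of \<open>F\<close> itself. For infinite \<open>X\<close> this is no restriction:
  the free object on \<open>X\<close> has at most as many elements as \<open>X\<close>, so it has a copy over this type, and
  the two universal properties make that copy isomorphic to \<open>F\<close> over \<open>X\<close>.\<close>

definition free_bounded_lattice ::
    "(lat_term \<times> lat_term) set \<Rightarrow> 'a gorder \<Rightarrow> 'a set \<Rightarrow> bool" where
  "free_bounded_lattice E F X \<longleftrightarrow>
     bounded_lattice F \<and> in_variety E F \<and> X \<subseteq> carrier F \<and>
     (\<forall>(L :: 'a gorder) g. bounded_lattice L \<and> in_variety E L \<and> g \<in> X \<rightarrow> carrier L \<longrightarrow>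
        (\<exists>!h. h \<in> bl_hom F L \<and> (\<forall>x\<in>X. h x = g x)))"

section \<open>Semilattice-metric spaces and covers\<close>

definition join0_semilattice :: "('s, 'c) gorder_scheme \<Rightarrow> bool" where
  "join0_semilattice S \<longleftrightarrow> upper_semilattice S \<and> weak_partial_order_bottom S"

definition join0_hom ::
    "('s, 'c) gorder_scheme \<Rightarrow> ('t, 'd) gorder_scheme \<Rightarrow> ('s \<Rightarrow> 't) \<Rightarrow> bool" where
  "join0_hom S T f \<longleftrightarrow> f \<in> carrier S \<rightarrow> carrier T \<and> f \<bottom>\<^bsub>S\<^esub> = \<bottom>\<^bsub>T\<^esub> \<and>
     (\<forall>x\<in>carrier S. \<forall>y\<in>carrier S. f (x \<squnion>\<^bsub>S\<^esub> y) = f x \<squnion>\<^bsub>T\<^esub> f y)"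

record ('a, 's) sm_space =
  sm_points :: "'a set"
  sm_dist :: "'a \<Rightarrow> 'a \<Rightarrow> 's"
  sm_vals :: "'s gorder"

definition semilattice_metric_space :: "('a, 's, 'z) sm_space_scheme \<Rightarrow> bool" where
  "semilattice_metric_space A \<longleftrightarrow>
     join0_semilattice (sm_vals A) \<and>
     (\<forall>x\<in>sm_points A. \<forall>y\<in>sm_points A. sm_dist A x y \<in> carrier (sm_vals A)) \<and>
     (\<forall>x\<in>sm_points A. sm_dist A x x = \<bottom>\<^bsub>sm_vals A\<^esub>) \<and>
     (\<forall>x\<in>sm_points A. \<forall>y\<in>sm_points A. sm_dist A x y = sm_dist A y x) \<and>
     (\<forall>x\<in>sm_points A. \<forall>y\<in>sm_points A. \<forall>z\<in>sm_points A.
        sm_dist A x z \<sqsubseteq>\<^bsub>sm_vals A\<^esub> sm_dist A x y \<squnion>\<^bsub>sm_vals A\<^esub> sm_dist A y z)"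

definition sm_morphism ::
    "('a, 's, 'y) sm_space_scheme \<Rightarrow> ('b, 't, 'z) sm_space_scheme \<Rightarrow>
      ('a \<Rightarrow> 'b) \<Rightarrow> ('s \<Rightarrow> 't) \<Rightarrow> bool" where
  "sm_morphism A B f f' \<longleftrightarrow>
     f \<in> sm_points A \<rightarrow> sm_points B \<and> join0_hom (sm_vals A) (sm_vals B) f' \<and>
     (\<forall>x\<in>sm_points A. \<forall>y\<in>sm_points A. sm_dist B (f x) (f y) = f' (sm_dist A x y))"

definition double_arrow ::
    "('a, 's, 'y) sm_space_scheme \<Rightarrow> ('b, 't, 'z) sm_space_scheme \<Rightarrow>
      ('a \<Rightarrow> 'b) \<Rightarrow> ('s \<Rightarrow> 't) \<Rightarrow> bool" where
  "double_arrow A B f f' \<longleftrightarrow> sm_morphism A B f f' \<and> f ` sm_points A = sm_points B"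

record ('a, 's) sm_cover = "('a, 's) sm_space" +
  sm_core :: "'a set"

definition semilattice_metric_cover :: "('a, 's, 'z) sm_cover_scheme \<Rightarrow> bool" where
  "semilattice_metric_cover B \<longleftrightarrow>
     semilattice_metric_space B \<and> sm_core B \<subseteq> sm_points B \<and>
     (\<forall>x\<in>sm_core B. \<forall>y\<in>sm_core B. \<forall>z\<in>sm_core B. \<exists>t\<in>sm_points B.
        sm_dist B x t \<sqsubseteq>\<^bsub>sm_vals B\<^esub> sm_dist B y z \<and> sm_dist B t z \<sqsubseteq>\<^bsub>sm_vals B\<^esub> sm_dist B x y)"

definition sm_flat :: "('a, 's, 'z) sm_cover_scheme \<Rightarrow> ('a, 's) sm_space" where
  "sm_flat B = \<lparr>sm_points = sm_core B, sm_dist = sm_dist B, sm_vals = sm_vals B\<rparr>"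

text \<open>The type arguments are the types of the points and of the distance values of the cover.\<close>

definition cpcp_retract :: "'b itself \<Rightarrow> 't itself \<Rightarrow> ('a, 's) sm_space \<Rightarrow> bool" where
  "cpcp_retract _ _ A \<longleftrightarrow> (\<exists>(B :: ('b, 't) sm_cover) f f'.
     semilattice_metric_cover B \<and> double_arrow (sm_flat B) A f f')"

section \<open>Algebras, congruences and extensions\<close>

record ('f, 'a) alg =
  alg_univ :: "'a set"
  alg_lang :: "'f set"
  alg_arity :: "'f \<Rightarrow> nat"
  alg_op :: "'f \<Rightarrow> 'a list \<Rightarrow> 'a"

definition is_algebra :: "('f, 'a) alg \<Rightarrow> bool" where
  "is_algebra A \<longleftrightarrow> alg_univ A \<noteq> {} \<and>
     (\<forall>f\<in>alg_lang A. \<forall>xs\<in>lists (alg_univ A).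
        length xs = alg_arity A f \<longrightarrow> alg_op A f xs \<in> alg_univ A)"

definition congruences :: "('f, 'a) alg \<Rightarrow> ('a \<times> 'a) set set" where
  "congruences A = {\<theta>. equiv (alg_univ A) \<theta> \<and>
     (\<forall>f\<in>alg_lang A. \<forall>xs ys. length xs = alg_arity A f \<and> list_all2 (\<lambda>x y. (x, y) \<in> \<theta>) xs ys \<longrightarrow>
        (alg_op A f xs, alg_op A f ys) \<in> \<theta>)}"

definition cong_gen :: "('f, 'a) alg \<Rightarrow> ('a \<times> 'a) set \<Rightarrow> ('a \<times> 'a) set" where
  "cong_gen A R = \<Inter>{\<theta> \<in> congruences A. R \<subseteq> \<theta>}"

definition principal_cong :: "('f, 'a) alg \<Rightarrow> 'a \<Rightarrow> 'a \<Rightarrow> ('a \<times> 'a) set" where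
  "principal_cong A x y = cong_gen A {(x, y)}"

definition Con_lat :: "('f, 'a) alg \<Rightarrow> ('a \<times> 'a) set gorder" where
  "Con_lat A = \<lparr>carrier = congruences A, eq = (=), le = (\<subseteq>)\<rparr>"

definition compact_element :: "('s, 'c) gorder_scheme \<Rightarrow> 's \<Rightarrow> bool" where
  "compact_element L c \<longleftrightarrow> c \<in> carrier L \<and>
     (\<forall>S \<subseteq> carrier L. c \<sqsubseteq>\<^bsub>L\<^esub> \<Squnion>\<^bsub>L\<^esub>S \<longrightarrow> (\<exists>T \<subseteq> S. finite T \<and> c \<sqsubseteq>\<^bsub>L\<^esub> \<Squnion>\<^bsub>L\<^esub>T))"

definition Con_c :: "('f, 'a) alg \<Rightarrow> ('a \<times> 'a) set gorder" where
  "Con_c A = \<lparr>carrier = {\<theta>. compact_element (Con_lat A) \<theta>}, eq = (=), le = (\<subseteq>)\<rparr>"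

definition alg_natural :: "('f, 'a) alg \<Rightarrow> ('a, ('a \<times> 'a) set) sm_space" where
  "alg_natural A = \<lparr>sm_points = alg_univ A, sm_dist = principal_cong A, sm_vals = Con_c A\<rparr>"

text \<open>Universes and languages are subsets of the types \<open>'a\<close> and \<open>'f\<close>, so an extension may add
  both elements and operation symbols.\<close>

definition cp_extension :: "('f, 'a) alg \<Rightarrow> ('f, 'a) alg \<Rightarrow> bool" where
  "cp_extension A B \<longleftrightarrow>
     is_algebra A \<and> is_algebra B \<and> alg_univ A \<subseteq> alg_univ B \<and> alg_lang A \<subseteq> alg_lang B \<and>
     (\<forall>f\<in>alg_lang A. alg_arity B f = alg_arity A f \<and>
        (\<forall>xs\<in>lists (alg_univ A). length xs = alg_arity A f \<longrightarrow> alg_op B f xs = alg_op A f xs)) \<and>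
     (\<forall>\<alpha>\<in>congruences A. \<exists>!\<beta>. \<beta> \<in> congruences B \<and> \<beta> \<inter> (alg_univ A \<times> alg_univ A) = \<alpha>)"

definition cpcp_extension :: "('f, 'a) alg \<Rightarrow> ('f, 'a) alg \<Rightarrow> bool" where
  "cpcp_extension A B \<longleftrightarrow> cp_extension A B \<and>
     (\<forall>x\<in>alg_univ A. \<forall>y\<in>alg_univ A. \<forall>z\<in>alg_univ A. \<exists>t\<in>alg_univ B.
        (x, t) \<in> principal_cong B y z \<and> (t, z) \<in> principal_cong B x y)"

section \<open>Bounded lattices as algebras\<close>

text \<open>The symbols \<open>Sym_extra e\<close> are not in the language of bounded lattices. They are there for the
  languages of extensions.\<close>

datatype 'e bl_symbol = Sym_join | Sym_meet | Sym_bot | Sym_top | Sym_extra 'e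

definition bl_algebra :: "('a, 'c) gorder_scheme \<Rightarrow> ('e bl_symbol, 'a) alg" where
  "bl_algebra L = \<lparr>
     alg_univ = carrier L,
     alg_lang = {Sym_join, Sym_meet, Sym_bot, Sym_top},
     alg_arity = (\<lambda>f. if f = Sym_join \<or> f = Sym_meet then 2 else 0),
     alg_op = (\<lambda>f xs. case f of
        Sym_join \<Rightarrow> xs ! 0 \<squnion>\<^bsub>L\<^esub> xs ! 1
      | Sym_meet \<Rightarrow> xs ! 0 \<sqinter>\<^bsub>L\<^esub> xs ! 1
      | Sym_bot \<Rightarrow> \<bottom>\<^bsub>L\<^esub>
      | Sym_top \<Rightarrow> \<top>\<^bsub>L\<^esub>
      | Sym_extra _ \<Rightarrow> undefined)\<rparr>"

section \<open>The two readings of the CP condition\<close>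

lemma congruencesI:
  assumes "equiv (alg_univ A) \<theta>"
    and "\<And>f xs ys. f \<in> alg_lang A \<Longrightarrow> length xs = alg_arity A f \<Longrightarrow>
      list_all2 (\<lambda>x y. (x, y) \<in> \<theta>) xs ys \<Longrightarrow> (alg_op A f xs, alg_op A f ys) \<in> \<theta>"
  shows "\<theta> \<in> congruences A"
  using assms by (simp add: congruences_def)

lemma congruences_restrict:
  assumes A: "is_algebra A" and sub: "alg_univ A \<subseteq> alg_univ B" "alg_lang A \<subseteq> alg_lang B"
    and ops: "\<forall>f\<in>alg_lang A. alg_arity B f = alg_arity A f \<and>
        (\<forall>xs\<in>lists (alg_univ A). length xs = alg_arity A f \<longrightarrow> alg_op B f xs = alg_op A f xs)"
    and \<beta>: "\<beta> \<in> congruences B"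
  shows "\<beta> \<inter> (alg_univ A \<times> alg_univ A) \<in> congruences A"
proof -
  let ?r = "\<beta> \<inter> (alg_univ A \<times> alg_univ A)"
  have e: "equiv (alg_univ B) \<beta>" using \<beta> by (simp add: congruences_def)
  have "equiv (alg_univ A) ?r"
  proof (rule equivI)
    show "refl_on (alg_univ A) ?r" using e sub by (auto simp: equiv_def refl_on_def)
    show "sym ?r" using e by (auto simp: equiv_def sym_def)
    show "trans ?r" using e unfolding equiv_def trans_def by blast
  qed auto
  moreover have "(alg_op A f xs, alg_op A f ys) \<in> ?r"
    if f: "f \<in> alg_lang A" and l: "length xs = alg_arity A f"
      and r: "list_all2 (\<lambda>x y. (x, y) \<in> ?r) xs ys" for f xs ys
  proof -
    have ly: "length ys = alg_arity A f" using r l by (auto dest: list_all2_lengthD)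
    have xs: "xs \<in> lists (alg_univ A)" and ys: "ys \<in> lists (alg_univ A)"
      using r by (auto simp: list_all2_conv_all_nth in_set_conv_nth)
    have rb: "list_all2 (\<lambda>x y. (x, y) \<in> \<beta>) xs ys" using r by (auto elim: list_all2_mono)
    have "(alg_op B f xs, alg_op B f ys) \<in> \<beta>"
      using \<beta> f l rb ops sub by (auto simp: congruences_def)
    moreover have "alg_op B f xs = alg_op A f xs" "alg_op B f ys = alg_op A f ys"
      using ops f xs ys l ly by auto
    moreover have "alg_op A f xs \<in> alg_univ A" "alg_op A f ys \<in> alg_univ A"
      using A f xs ys l ly by (auto simp: is_algebra_def)
    ultimately show ?thesis by simp
  qed
  ultimately show ?thesis by (rule congruencesI)
qed

lemma cong_gen_in:
  assumes B: "is_algebra B" and R: "R \<subseteq> alg_univ B \<times> alg_univ B"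
  shows "cong_gen B R \<in> congruences B"
proof -
  let ?F = "{\<theta> \<in> congruences B. R \<subseteq> \<theta>}"
  have top: "alg_univ B \<times> alg_univ B \<in> ?F"
  proof -
    have "(alg_op B f xs, alg_op B f ys) \<in> alg_univ B \<times> alg_univ B"
      if f: "f \<in> alg_lang B" and l: "length xs = alg_arity B f"
        and r: "list_all2 (\<lambda>x y. (x, y) \<in> alg_univ B \<times> alg_univ B) xs ys" for f xs ys
    proof -
      have "length ys = alg_arity B f" using r l by (auto dest: list_all2_lengthD)
      moreover have "xs \<in> lists (alg_univ B)" "ys \<in> lists (alg_univ B)"
        using r by (auto simp: list_all2_conv_all_nth in_set_conv_nth)
      ultimately show ?thesis using B f l by (auto simp: is_algebra_def)
    qed
    moreover have "equiv (alg_univ B) (alg_univ B \<times> alg_univ B)"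
      by (auto simp: equiv_def refl_on_def sym_def trans_def)
    ultimately have "alg_univ B \<times> alg_univ B \<in> congruences B" by (intro congruencesI)
    thus ?thesis using R by simp
  qed
  have eq: "equiv (alg_univ B) \<theta>" if "\<theta> \<in> ?F" for \<theta>
    using that by (simp add: congruences_def)
  have "equiv (alg_univ B) (\<Inter>?F)"
  proof (rule equivI)
    show "\<Inter>?F \<subseteq> alg_univ B \<times> alg_univ B" using top by blast
    show "refl_on (alg_univ B) (\<Inter>?F)" using eq by (auto simp: equiv_def refl_on_def)
    show "sym (\<Inter>?F)" using eq unfolding equiv_def sym_def by blast
    show "trans (\<Inter>?F)" using eq unfolding equiv_def trans_def by blast
  qed
  moreover have "(alg_op B f xs, alg_op B f ys) \<in> \<Inter>?F"
    if f: "f \<in> alg_lang B" and l: "length xs = alg_arity B f"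
      and r: "list_all2 (\<lambda>x y. (x, y) \<in> \<Inter>?F) xs ys" for f xs ys
  proof
    fix \<theta> assume \<theta>: "\<theta> \<in> ?F"
    have "list_all2 (\<lambda>x y. (x, y) \<in> \<theta>) xs ys"
      using r \<theta> by (elim list_all2_mono) blast
    thus "(alg_op B f xs, alg_op B f ys) \<in> \<theta>"
      using \<theta> f l by (simp add: congruences_def)
  qed
  ultimately show ?thesis unfolding cong_gen_def by (rule congruencesI)
qed

lemma cong_gen_superset: "R \<subseteq> cong_gen B R"
  by (auto simp: cong_gen_def)

lemma cong_gen_least: "\<theta> \<in> congruences B \<Longrightarrow> R \<subseteq> \<theta> \<Longrightarrow> cong_gen B R \<subseteq> \<theta>"
  by (auto simp: cong_gen_def)

text \<open>Unique extension of congruences is the same as the map \<open>Con A \<rightarrow> Con B\<close> sending a congruence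
  to the one it generates being an isomorphism.\<close>

lemma unique_extension_iff_iso:
  assumes A: "is_algebra A" and B: "is_algebra B"
    and sub: "alg_univ A \<subseteq> alg_univ B" "alg_lang A \<subseteq> alg_lang B"
    and ops: "\<forall>f\<in>alg_lang A. alg_arity B f = alg_arity A f \<and>
        (\<forall>xs\<in>lists (alg_univ A). length xs = alg_arity A f \<longrightarrow> alg_op B f xs = alg_op A f xs)"
  shows "(\<forall>\<alpha>\<in>congruences A. \<exists>!\<beta>. \<beta> \<in> congruences B \<and> \<beta> \<inter> (alg_univ A \<times> alg_univ A) = \<alpha>) \<longleftrightarrow>
    bij_betw (cong_gen B) (congruences A) (congruences B) \<and>
    (\<forall>\<alpha>\<in>congruences A. \<forall>\<alpha>'\<in>congruences A. \<alpha> \<subseteq> \<alpha>' \<longleftrightarrow> cong_gen B \<alpha> \<subseteq> cong_gen B \<alpha>')"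
    (is "?U \<longleftrightarrow> ?I")
proof -
  let ?res = "\<lambda>\<beta>. \<beta> \<inter> (alg_univ A \<times> alg_univ A)"
  have res: "?res \<beta> \<in> congruences A" if "\<beta> \<in> congruences B" for \<beta>
    using congruences_restrict[OF A sub ops that] .
  have inA: "\<alpha> \<subseteq> alg_univ A \<times> alg_univ A" if "\<alpha> \<in> congruences A" for \<alpha>
    using that by (auto simp: congruences_def equiv_def)
  have gen: "cong_gen B \<alpha> \<in> congruences B" if "\<alpha> \<in> congruences A" for \<alpha>
    by (rule cong_gen_in[OF B]) (use inA[OF that] sub in blast)
  show ?thesis
  proof
    assume U: ?U
    have rg: "?res (cong_gen B \<alpha>) = \<alpha>" if a: "\<alpha> \<in> congruences A" for \<alpha>
    proof -
      obtain \<beta> where b: "\<beta> \<in> congruences B" "?res \<beta> = \<alpha>" using U a by blast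
      have "cong_gen B \<alpha> \<subseteq> \<beta>" by (rule cong_gen_least) (use b in auto)
      thus ?thesis using b cong_gen_superset[of \<alpha> B] inA[OF a] by blast
    qed
    have gr: "cong_gen B (?res \<beta>) = \<beta>" if b: "\<beta> \<in> congruences B" for \<beta>
    proof -
      have "\<exists>!\<gamma>. \<gamma> \<in> congruences B \<and> ?res \<gamma> = ?res \<beta>" using U res[OF b] by (rule bspec)
      moreover have "cong_gen B (?res \<beta>) \<in> congruences B \<and>
          ?res (cong_gen B (?res \<beta>)) = ?res \<beta>"
        using gen[OF res[OF b]] rg[OF res[OF b]] by (rule conjI)
      moreover have "\<beta> \<in> congruences B \<and> ?res \<beta> = ?res \<beta>" using b by (rule conjI[OF _ refl])
      ultimately show ?thesis by (elim ex1E) metis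
    qed
    have "bij_betw (cong_gen B) (congruences A) (congruences B)"
    proof (rule bij_betw_byWitness[where f' = ?res])
      show "\<forall>\<alpha>\<in>congruences A. ?res (cong_gen B \<alpha>) = \<alpha>" using rg by (rule ballI)
      show "\<forall>\<beta>\<in>congruences B. cong_gen B (?res \<beta>) = \<beta>" using gr by (rule ballI)
      show "cong_gen B ` congruences A \<subseteq> congruences B" using gen by (rule image_subsetI)
      show "?res ` congruences B \<subseteq> congruences A" using res by (rule image_subsetI)
    qed
    moreover have "\<alpha> \<subseteq> \<alpha>' \<longleftrightarrow> cong_gen B \<alpha> \<subseteq> cong_gen B \<alpha>'"
      if a: "\<alpha> \<in> congruences A" "\<alpha>' \<in> congruences A" for \<alpha> \<alpha>'
    proof
      assume "\<alpha> \<subseteq> \<alpha>'"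
      thus "cong_gen B \<alpha> \<subseteq> cong_gen B \<alpha>'" by (auto simp: cong_gen_def)
    next
      assume "cong_gen B \<alpha> \<subseteq> cong_gen B \<alpha>'"
      thus "\<alpha> \<subseteq> \<alpha>'" using rg[OF a(1)] rg[OF a(2)] by blast
    qed
    ultimately show ?I by blast
  next
    assume I: ?I
    have inj: "inj_on (cong_gen B) (congruences A)"
      and surj: "cong_gen B ` congruences A = congruences B"
      using I by (auto simp: bij_betw_def)
    have gr: "cong_gen B (?res \<beta>) = \<beta>" if b: "\<beta> \<in> congruences B" for \<beta>
    proof
      show "cong_gen B (?res \<beta>) \<subseteq> \<beta>" by (rule cong_gen_least[OF b]) blast
      obtain \<alpha> where a: "\<alpha> \<in> congruences A" "\<beta> = cong_gen B \<alpha>" using surj b by blast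
      have "\<alpha> \<subseteq> ?res \<beta>" using a inA[OF a(1)] cong_gen_superset[of \<alpha> B] by blast
      hence "\<alpha> \<subseteq> cong_gen B (?res \<beta>)" using cong_gen_superset[of "?res \<beta>" B] by (rule subset_trans)
      from cong_gen_least[OF gen[OF res[OF b]] this]
      show "\<beta> \<subseteq> cong_gen B (?res \<beta>)" by (subst a(2))
    qed
    have rg: "?res (cong_gen B \<alpha>) = \<alpha>" if a: "\<alpha> \<in> congruences A" for \<alpha>
      using inj_onD[OF inj gr[OF gen[OF a]] res[OF gen[OF a]] a] .
    show ?U
    proof
      fix \<alpha> assume a: "\<alpha> \<in> congruences A"
      show "\<exists>!\<beta>. \<beta> \<in> congruences B \<and> ?res \<beta> = \<alpha>"
      proof (rule ex1I[of _ "cong_gen B \<alpha>"])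
        show "cong_gen B \<alpha> \<in> congruences B \<and> ?res (cong_gen B \<alpha>) = \<alpha>"
          using gen[OF a] rg[OF a] by (rule conjI)
        show "\<beta> = cong_gen B \<alpha>" if "\<beta> \<in> congruences B \<and> ?res \<beta> = \<alpha>" for \<beta>
          using gr[of \<beta>] that by metis
      qed
    qed
  qed
qed

end

theory Submission
  imports Defs "HOL-Library.Countable_Set"
begin

text \<open>
  A nondistributive variety contains a bounded lattice \<open>L\<close> in which some \<open>u\<close> has two distinct
  complements \<open>a\<close>, \<open>b\<close>. Fix a free generator \<open>w\<close> of \<open>F\<close>. A cover (or an extension) provides a
  point \<open>t\<close> for the triple \<open>\<bottom>, w, \<top>\<close>, and \<open>t\<close> behaves like a complement of \<open>w\<close>: the distance
  from \<open>t\<close> to another generator \<open>c\<close> is a compact congruence \<open>D c\<close> of \<open>F\<close> that vanishes in every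
  quotient where \<open>c\<close> becomes the complement of \<open>w\<close> in \<open>{\<bottom>, w, c, \<top>}\<close> and the generators outside
  \<open>{w, c}\<close> become \<open>\<bottom>\<close>. By compactness \<open>D c\<close> involves only finitely many generators, so among
  uncountably many generators there are \<open>c \<noteq> d\<close> such that \<open>D c\<close> does not involve \<open>d\<close> and \<open>D d\<close>
  does not involve \<open>c\<close>. The homomorphism to \<open>L\<close> with \<open>w \<mapsto> u\<close>, \<open>c \<mapsto> a\<close>, \<open>d \<mapsto> b\<close> then collapses
  both \<open>D c\<close> and \<open>D d\<close>, hence by the triangle inequality through \<open>t\<close> it identifies \<open>c\<close> with \<open>d\<close>,
  contradicting \<open>a \<noteq> b\<close>.
\<close>

section \<open>Lattices with unique relative complements\<close>

definition lat_modular :: "('a, 'c) gorder_scheme \<Rightarrow> bool" where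
  "lat_modular L \<longleftrightarrow> (\<forall>x\<in>carrier L. \<forall>y\<in>carrier L. \<forall>z\<in>carrier L.
     x \<sqsubseteq>\<^bsub>L\<^esub> z \<longrightarrow> x \<squnion>\<^bsub>L\<^esub> (y \<sqinter>\<^bsub>L\<^esub> z) = (x \<squnion>\<^bsub>L\<^esub> y) \<sqinter>\<^bsub>L\<^esub> z)"

text \<open>Uniqueness of relative complements. By a classical theorem it characterises distributive
  lattices; the direction developed below is that it implies distributivity, so a nondistributive
  lattice has an element with two complements in some interval.\<close>

definition lat_cancellative :: "('a, 'c) gorder_scheme \<Rightarrow> bool" where
  "lat_cancellative L \<longleftrightarrow> (\<forall>x\<in>carrier L. \<forall>y\<in>carrier L. \<forall>z\<in>carrier L.
     z \<sqinter>\<^bsub>L\<^esub> x = z \<sqinter>\<^bsub>L\<^esub> y \<longrightarrow> z \<squnion>\<^bsub>L\<^esub> x = z \<squnion>\<^bsub>L\<^esub> y \<longrightarrow> x = y)"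

section \<open>Order calculus and the passage from cancellation to distributivity\<close>

context lattice
begin

lemma le_joinI1: "x \<sqsubseteq> y \<Longrightarrow> x \<in> carrier L \<Longrightarrow> y \<in> carrier L \<Longrightarrow> z \<in> carrier L \<Longrightarrow> x \<sqsubseteq> y \<squnion> z"
  by (meson join_closed join_left le_trans)

lemma le_joinI2: "x \<sqsubseteq> z \<Longrightarrow> x \<in> carrier L \<Longrightarrow> y \<in> carrier L \<Longrightarrow> z \<in> carrier L \<Longrightarrow> x \<sqsubseteq> y \<squnion> z"
  by (meson join_closed join_right le_trans)

lemma meet_leI1: "x \<sqsubseteq> z \<Longrightarrow> x \<in> carrier L \<Longrightarrow> y \<in> carrier L \<Longrightarrow> z \<in> carrier L \<Longrightarrow> x \<sqinter> y \<sqsubseteq> z"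
  by (meson meet_closed meet_left le_trans)

lemma meet_leI2: "y \<sqsubseteq> z \<Longrightarrow> x \<in> carrier L \<Longrightarrow> y \<in> carrier L \<Longrightarrow> z \<in> carrier L \<Longrightarrow> x \<sqinter> y \<sqsubseteq> z"
  by (meson meet_closed meet_right le_trans)

lemma join_le_iff: "x \<in> carrier L \<Longrightarrow> y \<in> carrier L \<Longrightarrow> z \<in> carrier L \<Longrightarrow> x \<squnion> y \<sqsubseteq> z \<longleftrightarrow> x \<sqsubseteq> z \<and> y \<sqsubseteq> z"
  by (meson join_closed join_le join_left join_right le_trans)

lemma le_meet_iff: "x \<in> carrier L \<Longrightarrow> y \<in> carrier L \<Longrightarrow> z \<in> carrier L \<Longrightarrow> z \<sqsubseteq> x \<sqinter> y \<longleftrightarrow> z \<sqsubseteq> x \<and> z \<sqsubseteq> y"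
  by (meson meet_closed meet_le meet_left meet_right le_trans)

lemmas le_simps = join_le_iff le_meet_iff le_joinI1 le_joinI2 meet_leI1 meet_leI2

text \<open>For \<open>x \<sqsubseteq> z\<close> the two sides \<open>?a \<sqsubseteq> ?c\<close> of
  the modular law have the same meet and the same join with \<open>y\<close>. If they differed they
  would span a pentagon with \<open>y\<close>, so cancellation makes them equal.\<close>

lemma cancellative_modular:
  assumes "lat_cancellative L"
  shows "lat_modular L"
  unfolding lat_modular_def
proof (intro ballI impI)
  fix x y z assume [simp]: "x \<in> carrier L" "y \<in> carrier L" "z \<in> carrier L" and xz: "x \<sqsubseteq> z"
  let ?a = "x \<squnion> (y \<sqinter> z)" and ?c = "(x \<squnion> y) \<sqinter> z"
  have ac: "?a \<sqsubseteq> ?c"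
    using xz by (simp add: le_simps)
  have "y \<sqinter> ?c \<sqsubseteq> y \<sqinter> z"
    by (simp add: le_simps)
  then have "y \<sqinter> ?c \<sqsubseteq> y \<sqinter> ?a"
    by (simp add: le_meet_iff le_joinI2)
  moreover have "y \<sqinter> ?a \<sqsubseteq> y \<sqinter> ?c"
    using ac by (simp add: le_meet_iff meet_leI1 meet_leI2)
  ultimately have m: "y \<sqinter> ?a = y \<sqinter> ?c"
    by (intro le_antisym) auto
  have "x \<squnion> y \<sqsubseteq> y \<squnion> ?a"
    by (simp add: le_simps)
  then have "y \<squnion> ?c \<sqsubseteq> y \<squnion> ?a"
    by (simp add: join_le_iff meet_leI1 le_joinI1)
  moreover have "y \<squnion> ?a \<sqsubseteq> y \<squnion> ?c"
    using ac by (simp add: join_le_iff le_joinI1 le_joinI2)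
  ultimately have j: "y \<squnion> ?a = y \<squnion> ?c"
    by (intro le_antisym) auto
  show "?a = ?c"
    using assms[unfolded lat_cancellative_def, rule_format, OF _ _ _ m j] by simp
qed

lemma modularD:
  "lat_modular L \<Longrightarrow> x \<sqsubseteq> z \<Longrightarrow> x \<in> carrier L \<Longrightarrow> y \<in> carrier L \<Longrightarrow> z \<in> carrier L \<Longrightarrow>
    x \<squnion> (y \<sqinter> z) = (x \<squnion> y) \<sqinter> z"
  unfolding lat_modular_def by blast

lemma lat_modular_dual:
  assumes "lat_modular L" shows "lat_modular (inv_gorder L)"
  unfolding lat_modular_def
proof (simp, intro ballI impI)
  fix x y z assume [simp]: "x \<in> carrier L" "y \<in> carrier L" "z \<in> carrier L" and "z \<sqsubseteq> x"
  then show "x \<sqinter> (y \<squnion> z) = x \<sqinter> y \<squnion> z"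
    using modularD[OF assms, of z x y] by (simp add: join_comm[of L _ z] meet_comm[of L _ x])
qed

text \<open>Here \<open>d\<close> is the lower median of \<open>x\<close>, \<open>y\<close>,
  \<open>z\<close>, and the two factors are two of the three elements that form a diamond over
  \<open>d\<close> in a modular lattice. The modular law is applied twice: once with
  \<open>z \<sqinter> x\<close> below \<open>?p\<close>, once with \<open>d\<close> below
  \<open>d \<squnion> ?q\<close>.\<close>

lemma median_meet:
  assumes M: "lat_modular L" and [simp]: "x \<in> carrier L" "y \<in> carrier L" "z \<in> carrier L"
  defines "d \<equiv> (x \<sqinter> y) \<squnion> ((y \<sqinter> z) \<squnion> (z \<sqinter> x))"
  shows "(d \<squnion> (x \<sqinter> (y \<squnion> z))) \<sqinter> (d \<squnion> (y \<sqinter> (z \<squnion> x))) = d"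
proof -
  let ?p = "x \<sqinter> (y \<squnion> z)" and ?q = "y \<sqinter> (z \<squnion> x)"
  have [simp]: "d \<in> carrier L" by (simp add: d_def)
  have "d \<squnion> ?q \<sqsubseteq> (z \<sqinter> x) \<squnion> y"
    unfolding d_def by (simp add: le_simps)
  then have "?p \<sqinter> (d \<squnion> ?q) \<sqsubseteq> ((z \<sqinter> x) \<squnion> y) \<sqinter> ?p"
    by (simp add: le_meet_iff meet_leI1 meet_leI2)
  also have "\<dots> = (z \<sqinter> x) \<squnion> (y \<sqinter> ?p)"
    by (rule modularD[OF M, symmetric]) (simp_all add: le_simps)
  also have "\<dots> \<sqsubseteq> d"
    unfolding d_def by (simp add: le_simps)
  finally have "d \<squnion> (?p \<sqinter> (d \<squnion> ?q)) \<sqsubseteq> d"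
    by (simp add: join_le_iff)
  moreover have "d \<squnion> (?p \<sqinter> (d \<squnion> ?q)) = (d \<squnion> ?p) \<sqinter> (d \<squnion> ?q)"
    by (rule modularD[OF M]) (auto intro: join_left)
  ultimately show ?thesis
    by (intro le_antisym) (auto intro!: meet_le join_left)
qed

text \<open>This is \<open>median_meet\<close> read in the dual lattice, with the upper median
  \<open>e\<close> in place of \<open>d\<close>; modularity is self-dual.\<close>

lemma median_join:
  assumes M: "lat_modular L" and [simp]: "x \<in> carrier L" "y \<in> carrier L" "z \<in> carrier L"
  defines "e \<equiv> (x \<squnion> y) \<sqinter> ((y \<squnion> z) \<sqinter> (z \<squnion> x))"
  shows "(e \<sqinter> (x \<squnion> (y \<sqinter> z))) \<squnion> (e \<sqinter> (y \<squnion> (z \<sqinter> x))) = e"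
  using lattice.median_meet[OF dual_lattice lat_modular_dual[OF M], of x y z]
  by (simp add: e_def)

text \<open>In a modular lattice the two medians bound a possibly degenerate diamond, and a proper
  diamond violates cancellation. Equality of the medians together with modularity is what yields
  distributivity.\<close>

lemma modular_cancellative_median_eq:
  assumes M: "lat_modular L" and C: "lat_cancellative L"
    and [simp]: "x \<in> carrier L" "y \<in> carrier L" "z \<in> carrier L"
  shows "(x \<sqinter> y) \<squnion> ((y \<sqinter> z) \<squnion> (z \<sqinter> x)) = (x \<squnion> y) \<sqinter> ((y \<squnion> z) \<sqinter> (z \<squnion> x))"
proof -
  define d where "d \<equiv> \<lambda>x y z. (x \<sqinter> y) \<squnion> ((y \<sqinter> z) \<squnion> (z \<sqinter> x))"
  define e where "e \<equiv> \<lambda>x y z. (x \<squnion> y) \<sqinter> ((y \<squnion> z) \<sqinter> (z \<squnion> x))"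
  define v where "v \<equiv> \<lambda>x y z. d x y z \<squnion> (x \<sqinter> (y \<squnion> z))"
  have dc [simp]: "d x y z \<in> carrier L" and ec [simp]: "e x y z \<in> carrier L"
    and vc [simp]: "v x y z \<in> carrier L"
    if "x \<in> carrier L" "y \<in> carrier L" "z \<in> carrier L" for x y z
    using that by (simp_all add: d_def e_def v_def)
  have d_rot: "d y z x = d x y z" and e_rot: "e y z x = e x y z"
    if [simp]: "x \<in> carrier L" "y \<in> carrier L" "z \<in> carrier L" for x y z
  proof -
    show "d y z x = d x y z"
      by (rule le_antisym) (simp_all add: d_def join_le_iff le_joinI1 le_joinI2)
    show "e y z x = e x y z"
      by (rule le_antisym) (simp_all add: e_def le_meet_iff meet_leI1 meet_leI2)
  qed
  \<comment> \<open>\<open>v\<close> is defined from below, as \<open>d\<close> joined with a part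
    of \<open>x\<close>. The modular law rewrites it from above, so that \<open>median_join\<close>
    speaks of the same three elements as \<open>median_meet\<close>.\<close>
  have v_dual: "v x y z = e x y z \<sqinter> (x \<squnion> (y \<sqinter> z))"
    if [simp]: "x \<in> carrier L" "y \<in> carrier L" "z \<in> carrier L" for x y z
  proof -
    have "x \<sqinter> (y \<squnion> z) = x \<sqinter> e x y z"
      by (rule le_antisym) (simp_all add: e_def le_simps)
    then have "v x y z = d x y z \<squnion> (x \<sqinter> e x y z)" by (simp add: v_def)
    also have "\<dots> = (d x y z \<squnion> x) \<sqinter> e x y z"
      by (rule modularD[OF M]) (simp_all add: d_def e_def le_simps)
    also have "d x y z \<squnion> x = x \<squnion> (y \<sqinter> z)"
      by (rule le_antisym) (simp_all add: d_def le_simps)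
    finally show ?thesis by (simp add: meet_comm)
  qed
  have v_meet: "v x y z \<sqinter> v y z x = d x y z"
    if [simp]: "x \<in> carrier L" "y \<in> carrier L" "z \<in> carrier L" for x y z
    using median_meet[OF M, of x y z] by (simp add: v_def d_rot) (simp add: d_def)
  have v_join: "v x y z \<squnion> v y z x = e x y z"
    if [simp]: "x \<in> carrier L" "y \<in> carrier L" "z \<in> carrier L" for x y z
    using median_join[OF M, of x y z] by (simp add: v_dual e_rot) (simp add: e_def)
  \<comment> \<open>\<open>v x y z\<close>, \<open>v y z x\<close>, \<open>v z x y\<close> are the atoms of a copy of \<open>M\<^sub>3\<close> with bounds \<open>d x y z\<close>, \<open>e x y z\<close>,
    unless it collapses.\<close>
  have "v x y z = v y z x"
  proof (rule C[unfolded lat_cancellative_def, rule_format, of _ _ "v z x y"])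
    have "v z x y \<sqinter> v x y z = d x y z"
      using v_meet[of z x y] by (simp add: d_rot[of x y z] d_rot[of y z x])
    then show "v z x y \<sqinter> v x y z = v z x y \<sqinter> v y z x"
      using v_meet[of y z x] by (simp add: d_rot[of x y z] meet_comm[of _ "v z x y"])
    have "v z x y \<squnion> v x y z = e x y z"
      using v_join[of z x y] by (simp add: e_rot[of x y z] e_rot[of y z x])
    then show "v z x y \<squnion> v x y z = v z x y \<squnion> v y z x"
      using v_join[of y z x] by (simp add: e_rot[of x y z] join_comm[of _ "v z x y"])
  qed simp_all
  then have "v x y z \<sqinter> v x y z = d x y z" "v x y z \<squnion> v x y z = e x y z"
    using v_meet[of x y z] v_join[of x y z] by simp_all
  moreover have "v x y z \<sqinter> v x y z = v x y z" "v x y z \<squnion> v x y z = v x y z"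
    by (rule le_antisym; simp add: le_simps)+
  ultimately show ?thesis by (simp add: d_def e_def)
qed

text \<open>The median identity is cut by \<open>x\<close>: the upper median cut by \<open>x\<close>
  lies above \<open>x \<sqinter> (y \<squnion> z)\<close>, while the lower median cut by
  \<open>x\<close> reduces to \<open>?w\<close> by the modular law.\<close>

lemma cancellative_distributive:
  assumes C: "lat_cancellative L"
  shows "lat_distributive L"
  unfolding lat_distributive_def
proof (intro ballI)
  fix x y z assume [simp]: "x \<in> carrier L" "y \<in> carrier L" "z \<in> carrier L"
  note M = cancellative_modular[OF C]
  let ?w = "(x \<sqinter> y) \<squnion> (x \<sqinter> z)"
  have "x \<sqinter> (y \<squnion> z) \<sqsubseteq> ((x \<squnion> y) \<sqinter> ((y \<squnion> z) \<sqinter> (z \<squnion> x))) \<sqinter> x"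
    by (simp add: le_simps)
  also have "(x \<squnion> y) \<sqinter> ((y \<squnion> z) \<sqinter> (z \<squnion> x)) = (x \<sqinter> y) \<squnion> ((y \<sqinter> z) \<squnion> (z \<sqinter> x))"
    by (rule modular_cancellative_median_eq[OF M C, symmetric]) simp_all
  also have "\<dots> = ?w \<squnion> (y \<sqinter> z)"
    by (rule le_antisym) (simp_all add: le_simps)
  also have "(?w \<squnion> (y \<sqinter> z)) \<sqinter> x = ?w \<squnion> ((y \<sqinter> z) \<sqinter> x)"
    by (rule modularD[OF M, symmetric]) (simp_all add: le_simps)
  also have "\<dots> \<sqsubseteq> ?w"
    by (simp add: le_simps)
  finally have "x \<sqinter> (y \<squnion> z) \<sqsubseteq> ?w" by simp
  then show "x \<sqinter> (y \<squnion> z) = ?w"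
    by (rule le_antisym) (simp_all add: le_simps)
qed

lemma nondistributive_two_complements:
  assumes "\<not> lat_distributive L"
  obtains u a b where "u \<in> carrier L" "a \<in> carrier L" "b \<in> carrier L" "a \<noteq> b"
    "u \<sqinter> a = u \<sqinter> b" "u \<squnion> a = u \<squnion> b"
  using assms cancellative_distributive unfolding lat_cancellative_def by blast

end

section \<open>Transporting a lattice along an injection\<close>

text \<open>The universal property of \<open>F\<close> is tested on lattices over the type of
  \<open>F\<close>, so sublattices found over other types are copied there. Only the order is
  transported; joins and meets are recovered from it as suprema and infima. With the identity as
  \<open>\<phi>\<close> the same construction turns a subset of \<open>F\<close> into a
  lattice.\<close>

definition pullback_order :: "('a, 'c) gorder_scheme \<Rightarrow> 'b set \<Rightarrow> ('b \<Rightarrow> 'a) \<Rightarrow> 'b gorder" where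
  "pullback_order N K \<phi> = \<lparr>carrier = K, eq = (=), le = (\<lambda>x y. \<phi> x \<sqsubseteq>\<^bsub>N\<^esub> \<phi> y)\<rparr>"

lemma pullback_order_simps [simp]:
  "carrier (pullback_order N K \<phi>) = K"
  "x .=\<^bsub>pullback_order N K \<phi>\<^esub> y \<longleftrightarrow> x = y"
  "x \<sqsubseteq>\<^bsub>pullback_order N K \<phi>\<^esub> y \<longleftrightarrow> \<phi> x \<sqsubseteq>\<^bsub>N\<^esub> \<phi> y"
  by (simp_all add: pullback_order_def)

text \<open>\<open>K\<close> has no operations of its own, so closure is required of its image in
  \<open>N\<close>.\<close>

locale sublattice_embedding = lattice N for N :: "('a, 'c) gorder_scheme" (structure) +
  fixes K :: "'b set" and \<phi> :: "'b \<Rightarrow> 'a"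
  assumes inj: "inj_on \<phi> K" and into: "\<phi> ` K \<subseteq> carrier N"
    and closed: "\<And>x y. x \<in> K \<Longrightarrow> y \<in> K \<Longrightarrow> \<phi> x \<squnion> \<phi> y \<in> \<phi> ` K"
      "\<And>x y. x \<in> K \<Longrightarrow> y \<in> K \<Longrightarrow> \<phi> x \<sqinter> \<phi> y \<in> \<phi> ` K"
begin

abbreviation "L \<equiv> pullback_order N K \<phi>"

lemma into' [simp]: "x \<in> K \<Longrightarrow> \<phi> x \<in> carrier N"
  using into by blast

lemma L_partial_order: "partial_order L"
  by unfold_locales
     (auto intro: inj_onD[OF inj, OF le_antisym] le_trans simp: fun_eq_iff)

lemma L_join_least:
  assumes "x \<in> K" "y \<in> K" "z \<in> K" "\<phi> z = \<phi> x \<squnion> \<phi> y"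
  shows "least L z (Upper L {x, y})"
  using assms by (auto simp: least_def Upper_def join_le_iff join_left join_right)

lemma L_meet_greatest:
  assumes "x \<in> K" "y \<in> K" "z \<in> K" "\<phi> z = \<phi> x \<sqinter> \<phi> y"
  shows "greatest L z (Lower L {x, y})"
  using assms by (auto simp: greatest_def Lower_def le_meet_iff meet_left meet_right)

lemma L_lattice: "lattice L"
proof -
  interpret L: partial_order L by (rule L_partial_order)
  show ?thesis
  proof
    fix x y assume "x \<in> carrier L" "y \<in> carrier L"
    then have xy: "x \<in> K" "y \<in> K" by simp_all
    obtain z w where "z \<in> K" "\<phi> x \<squnion> \<phi> y = \<phi> z" "w \<in> K" "\<phi> x \<sqinter> \<phi> y = \<phi> w"
      using closed[OF xy] by blast
    then show "\<exists>s. least L s (Upper L {x, y})" "\<exists>s. greatest L s (Lower L {x, y})"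
      using L_join_least[OF xy] L_meet_greatest[OF xy] by metis+
  qed
qed

lemma
  assumes xy: "x \<in> K" "y \<in> K"
  shows join_closed_K: "x \<squnion>\<^bsub>L\<^esub> y \<in> K" and meet_closed_K: "x \<sqinter>\<^bsub>L\<^esub> y \<in> K"
    and embed_join: "\<phi> (x \<squnion>\<^bsub>L\<^esub> y) = \<phi> x \<squnion> \<phi> y"
    and embed_meet: "\<phi> (x \<sqinter>\<^bsub>L\<^esub> y) = \<phi> x \<sqinter> \<phi> y"
proof -
  interpret L: lattice L by (rule L_lattice)
  show "x \<squnion>\<^bsub>L\<^esub> y \<in> K" "x \<sqinter>\<^bsub>L\<^esub> y \<in> K"
    using xy L.join_closed[of x y] L.meet_closed[of x y] by simp_all
  obtain z w where z: "z \<in> K" "\<phi> x \<squnion> \<phi> y = \<phi> z" "w \<in> K" "\<phi> x \<sqinter> \<phi> y = \<phi> w"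
    using closed[OF xy] by blast
  have "x \<squnion>\<^bsub>L\<^esub> y = z"
    using L.least_unique[OF L_join_least[OF xy, of z]] L.sup_of_two_least[of x y] xy z
    by (simp add: join_def)
  then show "\<phi> (x \<squnion>\<^bsub>L\<^esub> y) = \<phi> x \<squnion> \<phi> y" using z by simp
  have "x \<sqinter>\<^bsub>L\<^esub> y = w"
    using L.greatest_unique[OF L_meet_greatest[OF xy, of w]] L.inf_of_two_greatest[of x y] xy z
    by (simp add: meet_def)
  then show "\<phi> (x \<sqinter>\<^bsub>L\<^esub> y) = \<phi> x \<sqinter> \<phi> y" using z by simp
qed

lemma embed_eval:
  assumes "range v \<subseteq> K"
  shows "lat_eval L v t \<in> K \<and> \<phi> (lat_eval L v t) = lat_eval N (\<phi> \<circ> v) t"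
  by (induction t) (use assms in \<open>auto simp: join_closed_K meet_closed_K embed_join embed_meet\<close>)

lemma L_in_variety:
  assumes "in_variety E N"
  shows "in_variety E L"
  unfolding in_variety_def
proof (intro conjI L_lattice ballI, clarify)
  fix s t and v :: "nat \<Rightarrow> 'b" assume st: "(s, t) \<in> E" and v: "range v \<subseteq> carrier L"
  then have vK: "range v \<subseteq> K" by simp
  then have "range (\<phi> \<circ> v) \<subseteq> carrier N" using into by auto
  then have "lat_eval N (\<phi> \<circ> v) s = lat_eval N (\<phi> \<circ> v) t"
    using assms st unfolding in_variety_def by blast
  then show "lat_eval L v s = lat_eval L v t"
    using embed_eval[OF vK] inj by (metis inj_onD)
qed

lemma L_bounded:
  assumes "o' \<in> K" "i \<in> K" "\<And>x. x \<in> K \<Longrightarrow> \<phi> o' \<sqsubseteq> \<phi> x" "\<And>x. x \<in> K \<Longrightarrow> \<phi> x \<sqsubseteq> \<phi> i"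
  shows "bounded_lattice L" "\<bottom>\<^bsub>L\<^esub> = o'" "\<top>\<^bsub>L\<^esub> = i"
proof -
  interpret L: lattice L by (rule L_lattice)
  show b: "bounded_lattice L"
    by unfold_locales (use assms in \<open>auto simp: least_def greatest_def\<close>)
  interpret L: bounded_lattice L by (rule b)
  show "\<bottom>\<^bsub>L\<^esub> = o'" "\<top>\<^bsub>L\<^esub> = i"
    using L.bottom_eq[of o'] L.top_eq[of i] assms by simp_all
qed

end

section \<open>A countable test lattice in which one element has two complements\<close>

instance lat_term :: countable
  by countable_datatype

lemma lat_eval_closed:
  assumes "lattice N" "range v \<subseteq> carrier N"
  shows "lat_eval N v t \<in> carrier N"
proof -
  interpret lattice N by fact
  show ?thesis by (induction t) (use assms(2) in auto)
qed

text \<open>In a nondistributive member take \<open>u\<close> with two relative complements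
  \<open>a\<close>, \<open>b\<close> and pass to the sublattice they generate. It is countable, so
  it has a copy over the type of any infinite set, and its bounds are the common meet and the common
  join, so relative complements become complements.\<close>

lemma nondistributive_variety_test_lattice:
  fixes A :: "'a set"
  assumes nd: "nondistributive_variety TYPE('n) E" and A: "infinite A"
  obtains L :: "'a gorder" and u a b where "bounded_lattice L" "in_variety E L"
    "u \<in> carrier L" "a \<in> carrier L" "b \<in> carrier L" "a \<noteq> b"
    "u \<sqinter>\<^bsub>L\<^esub> a = \<bottom>\<^bsub>L\<^esub>" "u \<sqinter>\<^bsub>L\<^esub> b = \<bottom>\<^bsub>L\<^esub>" "u \<squnion>\<^bsub>L\<^esub> a = \<top>\<^bsub>L\<^esub>" "u \<squnion>\<^bsub>L\<^esub> b = \<top>\<^bsub>L\<^esub>"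
proof -
  obtain N :: "'n gorder" where N: "in_variety E N" "\<not> lat_distributive N"
    using nd unfolding nondistributive_variety_def by blast
  interpret N: lattice N using N(1) by (simp add: in_variety_def)
  obtain u a b where uab [simp]: "u \<in> carrier N" "a \<in> carrier N" "b \<in> carrier N" and ab: "a \<noteq> b"
    and m: "u \<sqinter>\<^bsub>N\<^esub> a = u \<sqinter>\<^bsub>N\<^esub> b" and j: "u \<squnion>\<^bsub>N\<^esub> a = u \<squnion>\<^bsub>N\<^esub> b"
    using N.nondistributive_two_complements[OF N(2)] by blast
  \<comment> \<open>\<open>v\<close> lists the three generators. The values of all terms under
    \<open>v\<close> form the generated sublattice, which is countable because there are countably
    many terms.\<close>
  define v where "v \<equiv> \<lambda>n::nat. if n = 0 then u else if n = 1 then a else b"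
  have v: "range v \<subseteq> carrier N" by (auto simp: v_def)
  define M where "M = range (lat_eval N v)"
  have M_in: "M \<subseteq> carrier N" using lat_eval_closed[OF N.lattice_axioms v] by (auto simp: M_def)
  have M_closed: "p \<squnion>\<^bsub>N\<^esub> q \<in> M" "p \<sqinter>\<^bsub>N\<^esub> q \<in> M" if pq: "p \<in> M" "q \<in> M" for p q
  proof -
    obtain s t where "p = lat_eval N v s" "q = lat_eval N v t" using pq by (auto simp: M_def)
    then have "p \<squnion>\<^bsub>N\<^esub> q = lat_eval N v (LJoin s t)" "p \<sqinter>\<^bsub>N\<^esub> q = lat_eval N v (LMeet s t)" by simp_all
    then show "p \<squnion>\<^bsub>N\<^esub> q \<in> M" "p \<sqinter>\<^bsub>N\<^esub> q \<in> M" unfolding M_def by blast+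
  qed
  have vM: "v n \<in> M" for n unfolding M_def by (metis lat_eval.simps(1) rangeI)
  have uabM: "u \<in> M" "a \<in> M" "b \<in> M"
    using vM[of 0] vM[of 1] vM[of 2] by (simp_all add: v_def)
  \<comment> \<open>All three generators lie between the common meet and the common join, and this
    interval is closed under both operations.\<close>
  have M_bounds: "u \<sqinter>\<^bsub>N\<^esub> a \<sqsubseteq>\<^bsub>N\<^esub> lat_eval N v t \<and> lat_eval N v t \<sqsubseteq>\<^bsub>N\<^esub> u \<squnion>\<^bsub>N\<^esub> a" for t
  proof (induction t)
    case (LVar n)
    then show ?case
      using N.meet_left[of u a] N.meet_right[of u a] N.meet_right[of u b]
        N.join_left[of u a] N.join_right[of u a] N.join_right[of u b] m j
      by (simp add: v_def)
  next
    case (LJoin s t)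
    then show ?case
      using lat_eval_closed[OF N.lattice_axioms v, of s] lat_eval_closed[OF N.lattice_axioms v, of t]
      by (simp add: N.join_le_iff N.le_joinI1)
  next
    case (LMeet s t)
    then show ?case
      using lat_eval_closed[OF N.lattice_axioms v, of s] lat_eval_closed[OF N.lattice_axioms v, of t]
      by (simp add: N.le_meet_iff N.meet_leI1)
  qed
  \<comment> \<open>\<open>g\<close> numbers the elements of \<open>M\<close> and \<open>f\<close>
    sends numbers injectively into the target type; their composite \<open>h\<close> places
    \<open>M\<close> there, with inverse \<open>\<phi>\<close>.\<close>
  obtain f :: "nat \<Rightarrow> 'a" where f: "inj f" using infinite_countable_subset[OF A] by blast
  have "countable M" by (simp add: M_def)
  then obtain g :: "'n \<Rightarrow> nat" where g: "inj_on g M" unfolding countable_def by blast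
  define h where "h = f \<circ> g"
  have h: "inj_on h M" using f g by (auto simp: h_def inj_on_def)
  define K where "K = h ` M"
  define \<phi> where "\<phi> = inv_into M h"
  have \<phi>K: "\<phi> ` K = M" and \<phi>h: "\<And>p. p \<in> M \<Longrightarrow> \<phi> (h p) = p"
    using h by (simp_all add: K_def \<phi>_def inv_into_image_cancel)
  interpret S: sublattice_embedding N K \<phi>
  proof
    show "inj_on \<phi> K" unfolding K_def \<phi>_def by (rule inj_on_inv_into) simp
  qed (use M_in M_closed in \<open>auto simp: \<phi>K\<close>, (metis M_closed \<phi>K imageI)+)
  let ?o = "u \<sqinter>\<^bsub>N\<^esub> a" and ?i = "u \<squnion>\<^bsub>N\<^esub> a"
  have oi: "?o \<in> M" "?i \<in> M" using M_closed uabM by blast+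
  have "\<phi> (h ?o) \<sqsubseteq>\<^bsub>N\<^esub> \<phi> x \<and> \<phi> x \<sqsubseteq>\<^bsub>N\<^esub> \<phi> (h ?i)" if "x \<in> K" for x
  proof -
    have "\<phi> x \<in> M" using \<phi>K that by blast
    then show ?thesis using M_bounds oi by (auto simp: \<phi>h M_def)
  qed
  then have bd: "bounded_lattice S.L" "\<bottom>\<^bsub>S.L\<^esub> = h ?o" "\<top>\<^bsub>S.L\<^esub> = h ?i"
    using S.L_bounded[of "h ?o" "h ?i"] oi by (auto simp: K_def)
  have K: "h p \<in> K" if "p \<in> M" for p using that by (simp add: K_def)
  have eqK: "x = y" if "x \<in> K" "y \<in> K" "\<phi> x = \<phi> y" for x y
    using S.inj that by (auto dest: inj_onD)
  show ?thesis
  proof (rule that[OF bd(1) S.L_in_variety[OF N(1)]])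
    show "h u \<in> carrier S.L" "h a \<in> carrier S.L" "h b \<in> carrier S.L" using uabM by (simp_all add: K)
    show "h a \<noteq> h b" using ab h uabM by (auto dest: inj_onD)
    show "h u \<sqinter>\<^bsub>S.L\<^esub> h a = \<bottom>\<^bsub>S.L\<^esub>" "h u \<sqinter>\<^bsub>S.L\<^esub> h b = \<bottom>\<^bsub>S.L\<^esub>"
      "h u \<squnion>\<^bsub>S.L\<^esub> h a = \<top>\<^bsub>S.L\<^esub>" "h u \<squnion>\<^bsub>S.L\<^esub> h b = \<top>\<^bsub>S.L\<^esub>"
      unfolding bd
      by (rule eqK; use uabM oi m j in \<open>simp add: K S.join_closed_K S.meet_closed_K S.embed_join S.embed_meet \<phi>h\<close>)+
  qed
qed

section \<open>Homomorphisms from a free bounded lattice\<close>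

lemma uncountable_if_cardSuc_natLeq_le:
  fixes X :: "'a set"
  assumes "cardSuc natLeq \<le>o |X|"
  shows "uncountable X"
proof
  assume "countable X"
  then obtain f :: "'a \<Rightarrow> nat" where "inj_on f X" by (auto simp: countable_def)
  then have "|X| \<le>o |UNIV :: nat set|" using card_of_ordLeq[of X "UNIV :: nat set"] by blast
  then have "|X| \<le>o natLeq" using card_of_nat by (rule ordLeq_ordIso_trans)
  with assms have le: "cardSuc natLeq \<le>o natLeq" by (rule ordLeq_transitive)
  show False
    by (rule notE[OF not_ordLess_ordLeq[OF cardSuc_greater[OF natLeq_Card_order]] le])
qed

text \<open>For a countably infinite \<open>Y\<close> in \<open>X\<close> the sets
  \<open>S c\<close> with \<open>c \<in> Y\<close> cover only countably many elements, so some
  \<open>d\<close> lies outside \<open>Y\<close> and all of them. Since \<open>S d\<close> is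
  finite, it misses some \<open>c \<in> Y\<close>. This is where uncountability enters: on the
  natural numbers \<open>S n = {0..n}\<close> admits no such pair.\<close>

lemma uncountable_free_pair:
  assumes X: "uncountable X" and S: "\<And>c. c \<in> X \<Longrightarrow> finite (S c)"
  obtains c d where "c \<in> X" "d \<in> X" "c \<noteq> d" "c \<notin> S d" "d \<notin> S c"
proof -
  obtain Y where Y: "Y \<subseteq> X" "infinite Y" "countable Y"
    using infinite_countable_subset'[of X] X countable_finite[of X] by blast
  have "countable (S c)" if "c \<in> Y" for c
    using S[of c] Y(1) that by (simp add: countable_finite subsetD)
  then have "countable (Y \<union> (\<Union>c\<in>Y. S c))"
    using Y(3) by simp
  then obtain d where d: "d \<in> X" "d \<notin> Y" "d \<notin> (\<Union>c\<in>Y. S c)"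
    using X countable_subset[of X "Y \<union> (\<Union>c\<in>Y. S c)"] by blast
  obtain c where "c \<in> Y" "c \<notin> S d"
    using Y(2) S[OF d(1)] finite_subset[of Y "S d"] by blast
  with d Y(1) show ?thesis by (intro that[of c d]) auto
qed

section \<open>Bounded lattice homomorphisms and their kernels\<close>

lemma bl_hom_simps:
  assumes "h \<in> bl_hom F L"
  shows "x \<in> carrier F \<Longrightarrow> h x \<in> carrier L" "h \<bottom>\<^bsub>F\<^esub> = \<bottom>\<^bsub>L\<^esub>" "h \<top>\<^bsub>F\<^esub> = \<top>\<^bsub>L\<^esub>"
    "x \<in> carrier F \<Longrightarrow> y \<in> carrier F \<Longrightarrow> h (x \<squnion>\<^bsub>F\<^esub> y) = h x \<squnion>\<^bsub>L\<^esub> h y"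
    "x \<in> carrier F \<Longrightarrow> y \<in> carrier F \<Longrightarrow> h (x \<sqinter>\<^bsub>F\<^esub> y) = h x \<sqinter>\<^bsub>L\<^esub> h y"
  using assms by (auto simp: bl_hom_def PiE_iff)

lemma bl_algebra_simps [simp]:
  "alg_univ (bl_algebra L) = carrier L"
  "alg_lang (bl_algebra L) = {Sym_join, Sym_meet, Sym_bot, Sym_top}"
  "alg_arity (bl_algebra L) f = (if f = Sym_join \<or> f = Sym_meet then 2 else 0)"
  "alg_op (bl_algebra L) Sym_join xs = xs ! 0 \<squnion>\<^bsub>L\<^esub> xs ! 1"
  "alg_op (bl_algebra L) Sym_meet xs = xs ! 0 \<sqinter>\<^bsub>L\<^esub> xs ! 1"
  "alg_op (bl_algebra L) Sym_bot xs = \<bottom>\<^bsub>L\<^esub>"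
  "alg_op (bl_algebra L) Sym_top xs = \<top>\<^bsub>L\<^esub>"
  by (simp_all add: bl_algebra_def)

lemma is_algebra_bl_algebra:
  assumes "bounded_lattice L"
  shows "is_algebra (bl_algebra L)"
proof -
  interpret bounded_lattice L by fact
  show ?thesis
    unfolding is_algebra_def
    by (auto simp: in_lists_conv_set intro!: join_closed meet_closed)
qed

definition hom_kernel :: "('a, 'c) gorder_scheme \<Rightarrow> ('a \<Rightarrow> 'b) \<Rightarrow> ('a \<times> 'a) set" where
  "hom_kernel F h = {(p, q). p \<in> carrier F \<and> q \<in> carrier F \<and> h p = h q}"

lemma hom_kernel_congruence:
  assumes "bounded_lattice F" "h \<in> bl_hom F L"
  shows "hom_kernel F h \<in> congruences (bl_algebra F)"
proof -
  interpret bounded_lattice F by fact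
  note [simp] = bl_hom_simps[OF assms(2)]
  have "equiv (carrier F) (hom_kernel F h)"
    by (auto simp: equiv_def refl_on_def sym_def trans_def hom_kernel_def)
  then show ?thesis
    by (intro congruencesI) (auto simp: hom_kernel_def list_all2_conv_all_nth)
qed

text \<open>When the bounds differ, \<open>T\<close> is, read from its last two coordinates, the
  graph of the map from the square of \<open>{\<bottom>, \<top>}\<close> to \<open>L\<close> that
  sends \<open>(\<bottom>, \<top>)\<close> to \<open>u\<close> and
  \<open>(\<top>, \<bottom>)\<close> to \<open>a\<close>. Complementarity makes this map a
  homomorphism. Closure of the graph carries an induction over \<open>F\<close> that ties three
  homomorphisms together.\<close>

lemma complement_factor_closed:
  assumes "bounded_lattice L" and [simp]: "u \<in> carrier L" "a \<in> carrier L"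
    and [simp]: "u \<sqinter>\<^bsub>L\<^esub> a = \<bottom>\<^bsub>L\<^esub>" "u \<squnion>\<^bsub>L\<^esub> a = \<top>\<^bsub>L\<^esub>"
  defines "T \<equiv> {(\<bottom>\<^bsub>L\<^esub>, \<bottom>\<^bsub>L\<^esub>, \<bottom>\<^bsub>L\<^esub>), (u, \<bottom>\<^bsub>L\<^esub>, \<top>\<^bsub>L\<^esub>), (a, \<top>\<^bsub>L\<^esub>, \<bottom>\<^bsub>L\<^esub>), (\<top>\<^bsub>L\<^esub>, \<top>\<^bsub>L\<^esub>, \<top>\<^bsub>L\<^esub>)}"
  assumes "(x, x1, x2) \<in> T" "(y, y1, y2) \<in> T"
  shows "(x \<squnion>\<^bsub>L\<^esub> y, x1 \<squnion>\<^bsub>L\<^esub> y1, x2 \<squnion>\<^bsub>L\<^esub> y2) \<in> T"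
    "(x \<sqinter>\<^bsub>L\<^esub> y, x1 \<sqinter>\<^bsub>L\<^esub> y1, x2 \<sqinter>\<^bsub>L\<^esub> y2) \<in> T"
proof -
  interpret bounded_lattice L by fact
  have idem [simp]: "z \<squnion>\<^bsub>L\<^esub> z = z" "z \<sqinter>\<^bsub>L\<^esub> z = z" if "z \<in> carrier L" for z
    using that by (auto intro!: le_antisym simp: le_simps)
  have [simp]: "\<bottom>\<^bsub>L\<^esub> \<squnion>\<^bsub>L\<^esub> z = z" "\<bottom>\<^bsub>L\<^esub> \<sqinter>\<^bsub>L\<^esub> z = \<bottom>\<^bsub>L\<^esub>" "\<top>\<^bsub>L\<^esub> \<squnion>\<^bsub>L\<^esub> z = \<top>\<^bsub>L\<^esub>" "\<top>\<^bsub>L\<^esub> \<sqinter>\<^bsub>L\<^esub> z = z"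
    if "z \<in> carrier L" for z
    using that bottom_join[OF that] bottom_meet[OF that] top_join[OF that] top_meet[OF that]
    by (simp_all add: eq_is_equal)
  have [simp]: "z \<squnion>\<^bsub>L\<^esub> \<bottom>\<^bsub>L\<^esub> = z" "z \<sqinter>\<^bsub>L\<^esub> \<bottom>\<^bsub>L\<^esub> = \<bottom>\<^bsub>L\<^esub>" "z \<squnion>\<^bsub>L\<^esub> \<top>\<^bsub>L\<^esub> = \<top>\<^bsub>L\<^esub>" "z \<sqinter>\<^bsub>L\<^esub> \<top>\<^bsub>L\<^esub> = z"
    if "z \<in> carrier L" for z
    using that by (simp_all add: join_comm[of L z "\<bottom>\<^bsub>L\<^esub>"] join_comm[of L z "\<top>\<^bsub>L\<^esub>"]
      meet_comm[of L z "\<bottom>\<^bsub>L\<^esub>"] meet_comm[of L z "\<top>\<^bsub>L\<^esub>"])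
  have [simp]: "a \<sqinter>\<^bsub>L\<^esub> u = \<bottom>\<^bsub>L\<^esub>" "a \<squnion>\<^bsub>L\<^esub> u = \<top>\<^bsub>L\<^esub>"
    by (simp_all add: join_comm[of L a u] meet_comm[of L a u])
  show "(x \<squnion>\<^bsub>L\<^esub> y, x1 \<squnion>\<^bsub>L\<^esub> y1, x2 \<squnion>\<^bsub>L\<^esub> y2) \<in> T"
    "(x \<sqinter>\<^bsub>L\<^esub> y, x1 \<sqinter>\<^bsub>L\<^esub> y1, x2 \<sqinter>\<^bsub>L\<^esub> y2) \<in> T"
    using assms(7,8) unfolding T_def by (elim insertE emptyE; simp)+
qed

section \<open>Consequences of freeness for homomorphisms and kernels\<close>

context
  fixes E and F :: "'a gorder" and X :: "'a set"
  assumes free: "free_bounded_lattice E F X"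
begin

lemma F_bounded: "bounded_lattice F" and F_variety: "in_variety E F" and X_F: "X \<subseteq> carrier F"
  using free by (simp_all add: free_bounded_lattice_def)

lemma free_hom:
  fixes L :: "'a gorder"
  assumes "bounded_lattice L" "in_variety E L" "g \<in> X \<rightarrow> carrier L"
  obtains h where "h \<in> bl_hom F L" "\<And>x. x \<in> X \<Longrightarrow> h x = g x"
proof -
  have "\<exists>!h. h \<in> bl_hom F L \<and> (\<forall>x\<in>X. h x = g x)"
    using assms free unfolding free_bounded_lattice_def by blast
  then show ?thesis using that by blast
qed

lemma free_hom_unique:
  fixes L :: "'a gorder"
  assumes "bounded_lattice L" "in_variety E L" "h \<in> bl_hom F L" "h' \<in> bl_hom F L"
    "\<And>x. x \<in> X \<Longrightarrow> h x = h' x"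
  shows "h = h'"
proof -
  have "h \<in> X \<rightarrow> carrier L" using assms(3) X_F by (auto simp: bl_hom_def)
  then have "\<exists>!k. k \<in> bl_hom F L \<and> (\<forall>x\<in>X. k x = h x)"
    using assms(1,2) free unfolding free_bounded_lattice_def by blast
  then show ?thesis using assms(3-5) by metis
qed

text \<open>The elements satisfying \<open>P\<close> form a bounded sublattice that contains
  \<open>X\<close> and satisfies the identities in \<open>E\<close>. The universal property gives a
  homomorphism from \<open>F\<close> into it fixing \<open>X\<close>; followed by the inclusion it
  is the identity by uniqueness, so the sublattice is all of \<open>F\<close>.\<close>

lemma free_induct [consumes 1, case_names gen bot top join meet]:
  assumes p: "p \<in> carrier F"
    and gen: "\<And>x. x \<in> X \<Longrightarrow> P x" and bot: "P \<bottom>\<^bsub>F\<^esub>" and top: "P \<top>\<^bsub>F\<^esub>"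
    and join: "\<And>x y. x \<in> carrier F \<Longrightarrow> y \<in> carrier F \<Longrightarrow> P x \<Longrightarrow> P y \<Longrightarrow> P (x \<squnion>\<^bsub>F\<^esub> y)"
    and meet: "\<And>x y. x \<in> carrier F \<Longrightarrow> y \<in> carrier F \<Longrightarrow> P x \<Longrightarrow> P y \<Longrightarrow> P (x \<sqinter>\<^bsub>F\<^esub> y)"
  shows "P p"
proof -
  interpret F: bounded_lattice F by (rule F_bounded)
  define S where "S = {p \<in> carrier F. P p}"
  have S_closed: "x \<squnion>\<^bsub>F\<^esub> y \<in> S" "x \<sqinter>\<^bsub>F\<^esub> y \<in> S" if "x \<in> S" "y \<in> S" for x y
    using that unfolding S_def by (simp_all add: join meet)
  have "S \<subseteq> carrier F" by (auto simp: S_def)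
  then have "sublattice_embedding F S (\<lambda>x. x)"
    by - (rule sublattice_embedding.intro[OF F.lattice_axioms], rule sublattice_embedding_axioms.intro,
      simp_all add: S_closed)
  then interpret S: sublattice_embedding F S "\<lambda>x. x" .
  note S.into' [simp del] \<comment> \<open>with \<open>\<phi>\<close> the identity it loops together with \<open>S_def\<close>\<close>
  have oi: "\<bottom>\<^bsub>F\<^esub> \<in> S" "\<top>\<^bsub>F\<^esub> \<in> S" by (simp_all add: S_def bot top)
  have bd: "bounded_lattice S.L" "\<bottom>\<^bsub>S.L\<^esub> = \<bottom>\<^bsub>F\<^esub>" "\<top>\<^bsub>S.L\<^esub> = \<top>\<^bsub>F\<^esub>"
    using S.L_bounded[OF oi] by (auto simp: S_def)
  have "(\<lambda>x. x) \<in> X \<rightarrow> carrier S.L" using gen X_F by (auto simp: S_def)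
  then obtain h where h: "h \<in> bl_hom F S.L" "\<And>x. x \<in> X \<Longrightarrow> h x = x"
    using free_hom[OF bd(1) S.L_in_variety[OF F_variety]] by blast
  have "h \<in> bl_hom F F"
    using h(1) \<open>S \<subseteq> carrier F\<close> unfolding bl_hom_def bd
    by (auto simp: PiE_iff S.embed_join S.embed_meet)
  \<comment> \<open>Members of \<open>bl_hom\<close> are extensional functions, so the identity is
    restricted to the carrier before uniqueness is applied.\<close>
  moreover have "restrict (\<lambda>x. x) (carrier F) \<in> bl_hom F F"
    by (auto simp: bl_hom_def)
  ultimately have "h = restrict (\<lambda>x. x) (carrier F)"
    by (rule free_hom_unique[OF F_bounded F_variety]) (use h(2) X_F in auto)
  then have "h p = p" using p by simp
  then show ?thesis using bl_hom_simps(1)[OF h(1) p] by (simp add: S_def)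
qed

text \<open>Every element of \<open>F\<close> is built from finitely many generators. No term is
  chosen for it; the support is described by its effect on homomorphisms, and supports are united at
  joins and meets.\<close>

lemma finite_support:
  fixes L :: "('b, 'c) gorder_scheme"
  assumes "p \<in> carrier F"
  shows "\<exists>S\<subseteq>X. finite S \<and> (\<forall>h\<in>bl_hom F L. \<forall>h'\<in>bl_hom F L. (\<forall>x\<in>S. h x = h' x) \<longrightarrow> h p = h' p)"
  using assms
proof (induction rule: free_induct)
  case (gen x)
  then show ?case by (intro exI[of _ "{x}"]) simp
next
  case bot
  then show ?case by (intro exI[of _ "{}"]) (simp add: bl_hom_simps)
next
  case top
  then show ?case by (intro exI[of _ "{}"]) (simp add: bl_hom_simps)
next
  case (join x y)
  obtain S where S: "S \<subseteq> X" "finite S"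
    "\<forall>h\<in>bl_hom F L. \<forall>h'\<in>bl_hom F L. (\<forall>x\<in>S. h x = h' x) \<longrightarrow> h x = h' x"
    using join.IH(1) by blast
  obtain T where T: "T \<subseteq> X" "finite T"
    "\<forall>h\<in>bl_hom F L. \<forall>h'\<in>bl_hom F L. (\<forall>x\<in>T. h x = h' x) \<longrightarrow> h y = h' y"
    using join.IH(2) by blast
  show ?case
  proof (intro exI[of _ "S \<union> T"] conjI ballI impI)
    show "S \<union> T \<subseteq> X" "finite (S \<union> T)" using S(1,2) T(1,2) by simp_all
    fix h h' assume h: "h \<in> bl_hom F L" "h' \<in> bl_hom F L" "\<forall>x\<in>S \<union> T. h x = h' x"
    then show "h (x \<squnion>\<^bsub>F\<^esub> y) = h' (x \<squnion>\<^bsub>F\<^esub> y)"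
      using S(3)[rule_format, OF h(1,2)] T(3)[rule_format, OF h(1,2)] join.hyps
      by (simp add: bl_hom_simps(4)[OF h(1)] bl_hom_simps(4)[OF h(2)])
  qed
next
  case (meet x y)
  obtain S where S: "S \<subseteq> X" "finite S"
    "\<forall>h\<in>bl_hom F L. \<forall>h'\<in>bl_hom F L. (\<forall>x\<in>S. h x = h' x) \<longrightarrow> h x = h' x"
    using meet.IH(1) by blast
  obtain T where T: "T \<subseteq> X" "finite T"
    "\<forall>h\<in>bl_hom F L. \<forall>h'\<in>bl_hom F L. (\<forall>x\<in>T. h x = h' x) \<longrightarrow> h y = h' y"
    using meet.IH(2) by blast
  show ?case
  proof (intro exI[of _ "S \<union> T"] conjI ballI impI)
    show "S \<union> T \<subseteq> X" "finite (S \<union> T)" using S(1,2) T(1,2) by simp_all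
    fix h h' assume h: "h \<in> bl_hom F L" "h' \<in> bl_hom F L" "\<forall>x\<in>S \<union> T. h x = h' x"
    then show "h (x \<sqinter>\<^bsub>F\<^esub> y) = h' (x \<sqinter>\<^bsub>F\<^esub> y)"
      using S(3)[rule_format, OF h(1,2)] T(3)[rule_format, OF h(1,2)] meet.hyps
      by (simp add: bl_hom_simps(5)[OF h(1)] bl_hom_simps(5)[OF h(2)])
  qed
qed

text \<open>\<open>h1\<close> sends \<open>c\<close> to \<open>\<top>\<close> and all other
  generators to \<open>\<bottom>\<close>; \<open>h2\<close> does the same with \<open>w\<close>. The
  two conditions on \<open>Y\<close> place it in both kernels. The value of \<open>\<pi>\<close> is
  a function of the values of \<open>h1\<close> and \<open>h2\<close>, so the intersection of their
  kernels lies in the kernel of \<open>\<pi>\<close>.\<close>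

lemma hom_kernel_complement:
  fixes L :: "'a gorder"
  assumes L: "bounded_lattice L" "in_variety E L" and ua: "u \<in> carrier L" "a \<in> carrier L"
    "u \<sqinter>\<^bsub>L\<^esub> a = \<bottom>\<^bsub>L\<^esub>" "u \<squnion>\<^bsub>L\<^esub> a = \<top>\<^bsub>L\<^esub>" and ne: "\<bottom>\<^bsub>L\<^esub> \<noteq> \<top>\<^bsub>L\<^esub>"
    and w: "w \<in> X" "c \<in> X" "w \<noteq> c"
    and Y: "\<And>\<psi>. \<psi> \<in> congruences (bl_algebra F :: ('e bl_symbol, 'a) alg) \<Longrightarrow>
        (\<bottom>\<^bsub>F\<^esub>, w) \<in> \<psi> \<Longrightarrow> (\<top>\<^bsub>F\<^esub>, c) \<in> \<psi> \<Longrightarrow> Y \<subseteq> \<psi>"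
      "\<And>\<psi>. \<psi> \<in> congruences (bl_algebra F :: ('e bl_symbol, 'a) alg) \<Longrightarrow>
        (w, \<top>\<^bsub>F\<^esub>) \<in> \<psi> \<Longrightarrow> (\<bottom>\<^bsub>F\<^esub>, c) \<in> \<psi> \<Longrightarrow> Y \<subseteq> \<psi>"
    and \<pi>: "\<pi> \<in> bl_hom F L" "\<pi> w = u" "\<pi> c = a" "\<And>x. x \<in> X \<Longrightarrow> x \<noteq> w \<Longrightarrow> x \<noteq> c \<Longrightarrow> \<pi> x = \<bottom>\<^bsub>L\<^esub>"
  shows "Y \<subseteq> hom_kernel F \<pi>"
proof -
  interpret F: bounded_lattice F by (rule F_bounded)
  interpret L: bounded_lattice L by fact
  obtain h1 where h1: "h1 \<in> bl_hom F L" "\<And>x. x \<in> X \<Longrightarrow> h1 x = (if x = c then \<top>\<^bsub>L\<^esub> else \<bottom>\<^bsub>L\<^esub>)"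
    using free_hom[OF L, of "\<lambda>x. if x = c then \<top>\<^bsub>L\<^esub> else \<bottom>\<^bsub>L\<^esub>"] by auto
  obtain h2 where h2: "h2 \<in> bl_hom F L" "\<And>x. x \<in> X \<Longrightarrow> h2 x = (if x = w then \<top>\<^bsub>L\<^esub> else \<bottom>\<^bsub>L\<^esub>)"
    using free_hom[OF L, of "\<lambda>x. if x = w then \<top>\<^bsub>L\<^esub> else \<bottom>\<^bsub>L\<^esub>"] by auto
  have wc [simp]: "w \<in> carrier F" "c \<in> carrier F" using w X_F by auto
  have Y1: "Y \<subseteq> hom_kernel F h1"
    by (rule Y(1)[OF hom_kernel_congruence[OF F_bounded h1(1)]])
       (use w h1(2) in \<open>simp_all add: hom_kernel_def bl_hom_simps(2,3)[OF h1(1)]\<close>)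
  have Y2: "Y \<subseteq> hom_kernel F h2"
    by (rule Y(2)[OF hom_kernel_congruence[OF F_bounded h2(1)]])
       (use w h2(2) in \<open>simp_all add: hom_kernel_def bl_hom_simps(2,3)[OF h2(1)]\<close>)
  have T: "(\<pi> p, h1 p, h2 p) \<in> {(\<bottom>\<^bsub>L\<^esub>, \<bottom>\<^bsub>L\<^esub>, \<bottom>\<^bsub>L\<^esub>), (u, \<bottom>\<^bsub>L\<^esub>, \<top>\<^bsub>L\<^esub>), (a, \<top>\<^bsub>L\<^esub>, \<bottom>\<^bsub>L\<^esub>), (\<top>\<^bsub>L\<^esub>, \<top>\<^bsub>L\<^esub>, \<top>\<^bsub>L\<^esub>)}"
    if "p \<in> carrier F" for p
    using that
  proof (induction rule: free_induct)
    case (gen x)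
    then show ?case
      using w \<pi>(2,3) \<pi>(4)[of x] h1(2)[of x] h2(2)[of x] by (cases "x = w"; cases "x = c") simp_all
  next
    case (join x y)
    show ?case
      unfolding bl_hom_simps(4)[OF \<pi>(1) join(1,2)] bl_hom_simps(4)[OF h1(1) join(1,2)]
        bl_hom_simps(4)[OF h2(1) join(1,2)]
      by (rule complement_factor_closed(1)[OF L(1) ua join(3,4)])
  next
    case (meet x y)
    show ?case
      unfolding bl_hom_simps(5)[OF \<pi>(1) meet(1,2)] bl_hom_simps(5)[OF h1(1) meet(1,2)]
        bl_hom_simps(5)[OF h2(1) meet(1,2)]
      by (rule complement_factor_closed(2)[OF L(1) ua meet(3,4)])
  qed (simp_all add: bl_hom_simps(2,3)[OF \<pi>(1)] bl_hom_simps(2,3)[OF h1(1)] bl_hom_simps(2,3)[OF h2(1)])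
  \<comment> \<open>As \<open>\<bottom>\<close> and \<open>\<top>\<close> differ, the pair
    \<open>h1 p\<close>, \<open>h2 p\<close> selects exactly one of the four rows.\<close>
  have eq: "\<pi> p = (if h1 p = \<bottom>\<^bsub>L\<^esub> then if h2 p = \<bottom>\<^bsub>L\<^esub> then \<bottom>\<^bsub>L\<^esub> else u else if h2 p = \<bottom>\<^bsub>L\<^esub> then a else \<top>\<^bsub>L\<^esub>)"
    if "p \<in> carrier F" for p
    using T[OF that] ne by (elim insertE emptyE) simp_all
  show ?thesis
  proof (rule subrelI)
    fix p q assume "(p, q) \<in> Y"
    then have pq: "p \<in> carrier F" "q \<in> carrier F" "h1 p = h1 q" "h2 p = h2 q"
      using Y1 Y2 by (auto simp: hom_kernel_def)
    then have "\<pi> p = \<pi> q" using eq[of p] eq[of q] by simp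
    then show "(p, q) \<in> hom_kernel F \<pi>" using pq by (simp add: hom_kernel_def)
  qed
qed

text \<open>Common core of the two negative results. \<open>Y c\<close> stands for a finite
  generating set of the distance from a point \<open>t\<close> to \<open>c\<close>, where
  \<open>t\<close> imitates a complement of \<open>w\<close>. The first two conditions on
  congruences express the defining inequalities of \<open>t\<close>, the third the triangle
  inequality through \<open>t\<close>. The point itself is left out, since it lives in different
  structures in the two applications.\<close>

lemma no_complement_family:
  assumes nd: "nondistributive_variety TYPE('n) E" and X: "uncountable X" and w: "w \<in> X"
    and fin: "\<And>c. c \<in> X \<Longrightarrow> finite (Y c)" and YF: "\<And>c. c \<in> X \<Longrightarrow> Y c \<subseteq> carrier F \<times> carrier F"
    and Y: "\<And>c \<psi>. c \<in> X \<Longrightarrow> \<psi> \<in> congruences (bl_algebra F :: ('e bl_symbol, 'a) alg) \<Longrightarrow>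
        (\<bottom>\<^bsub>F\<^esub>, w) \<in> \<psi> \<Longrightarrow> (\<top>\<^bsub>F\<^esub>, c) \<in> \<psi> \<Longrightarrow> Y c \<subseteq> \<psi>"
      "\<And>c \<psi>. c \<in> X \<Longrightarrow> \<psi> \<in> congruences (bl_algebra F :: ('e bl_symbol, 'a) alg) \<Longrightarrow>
        (w, \<top>\<^bsub>F\<^esub>) \<in> \<psi> \<Longrightarrow> (\<bottom>\<^bsub>F\<^esub>, c) \<in> \<psi> \<Longrightarrow> Y c \<subseteq> \<psi>"
      "\<And>c d \<psi>. c \<in> X \<Longrightarrow> d \<in> X \<Longrightarrow> \<psi> \<in> congruences (bl_algebra F :: ('e bl_symbol, 'a) alg) \<Longrightarrow>
        Y c \<subseteq> \<psi> \<Longrightarrow> Y d \<subseteq> \<psi> \<Longrightarrow> (c, d) \<in> \<psi>"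
  shows False
proof -
  have "infinite X" using X countable_finite by blast
  then obtain L :: "'a gorder" and u a b where L: "bounded_lattice L" "in_variety E L"
    and [simp]: "u \<in> carrier L" "a \<in> carrier L" "b \<in> carrier L" and ab: "a \<noteq> b"
    and comp: "u \<sqinter>\<^bsub>L\<^esub> a = \<bottom>\<^bsub>L\<^esub>" "u \<sqinter>\<^bsub>L\<^esub> b = \<bottom>\<^bsub>L\<^esub>" "u \<squnion>\<^bsub>L\<^esub> a = \<top>\<^bsub>L\<^esub>" "u \<squnion>\<^bsub>L\<^esub> b = \<top>\<^bsub>L\<^esub>"
    using nondistributive_variety_test_lattice[OF nd, of X] by metis
  interpret F: bounded_lattice F by (rule F_bounded)
  interpret L: bounded_lattice L by fact
  have ne: "\<bottom>\<^bsub>L\<^esub> \<noteq> \<top>\<^bsub>L\<^esub>"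
  proof
    assume eq: "\<bottom>\<^bsub>L\<^esub> = \<top>\<^bsub>L\<^esub>"
    have "z = \<bottom>\<^bsub>L\<^esub>" if "z \<in> carrier L" for z
      using that eq L.bottom_lower[OF that] L.top_higher[OF that] by (intro L.le_antisym) auto
    then show False using ab by (metis \<open>a \<in> carrier L\<close> \<open>b \<in> carrier L\<close>)
  qed
  have "\<forall>p\<in>carrier F. \<exists>S\<subseteq>X. finite S \<and>
      (\<forall>h\<in>bl_hom F L. \<forall>h'\<in>bl_hom F L. (\<forall>x\<in>S. h x = h' x) \<longrightarrow> h p = h' p)"
    using finite_support by blast
  from bchoice[OF this] obtain supp where supp: "\<And>p. p \<in> carrier F \<Longrightarrow> supp p \<subseteq> X"
    "\<And>p. p \<in> carrier F \<Longrightarrow> finite (supp p)"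
    "\<And>p h h'. p \<in> carrier F \<Longrightarrow> h \<in> bl_hom F L \<Longrightarrow> h' \<in> bl_hom F L \<Longrightarrow> \<forall>x\<in>supp p. h x = h' x \<Longrightarrow> h p = h' p"
    by blast
  \<comment> \<open>\<open>S c\<close> gathers the generators on which the pairs in
    \<open>Y c\<close> depend.\<close>
  define S where "S c = (\<Union>(p, q)\<in>Y c. supp p \<union> supp q)" for c
  have finS: "finite (S c)" if c: "c \<in> X - {w}" for c
    unfolding S_def
  proof (rule finite_UN_I)
    show "finite (Y c)" using fin c by blast
    fix r assume "r \<in> Y c"
    then have "fst r \<in> carrier F" "snd r \<in> carrier F" using YF[of c] c by auto
    then show "finite (case r of (p, q) \<Rightarrow> supp p \<union> supp q)" using supp(2) by (simp add: split_beta)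
  qed
  \<comment> \<open>\<open>w\<close> is set aside before the pair \<open>c\<close>, \<open>d\<close>
    is chosen, because its image is prescribed to be \<open>u\<close>.\<close>
  have unc: "uncountable (X - {w})" using X by (simp add: uncountable_minus_countable)
  obtain c d where cd: "c \<in> X - {w}" "d \<in> X - {w}" "c \<noteq> d" "c \<notin> S d" "d \<notin> S c"
    by (rule uncountable_free_pair[OF unc finS])
  obtain \<pi> where \<pi>: "\<pi> \<in> bl_hom F L"
    "\<And>x. x \<in> X \<Longrightarrow> \<pi> x = (if x = w then u else if x = c then a else if x = d then b else \<bottom>\<^bsub>L\<^esub>)"
    by (rule free_hom[OF L, of "\<lambda>x. if x = w then u else if x = c then a else if x = d then b else \<bottom>\<^bsub>L\<^esub>"]) auto
  \<comment> \<open>\<open>\<pi>\<close> may be nonzero at three generators, so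
    \<open>hom_kernel_complement\<close> does not apply to it directly. The homomorphism
    \<open>\<rho>\<close> keeps only the values at \<open>w\<close> and \<open>e\<close>; it agrees
    with \<open>\<pi>\<close> on \<open>S e\<close>, hence on both entries of every pair in
    \<open>Y e\<close>.\<close>
  have key: "Y e \<subseteq> hom_kernel F \<pi>"
    if e: "e \<in> X" "e \<noteq> w" "\<pi> e \<in> carrier L" "u \<sqinter>\<^bsub>L\<^esub> \<pi> e = \<bottom>\<^bsub>L\<^esub>" "u \<squnion>\<^bsub>L\<^esub> \<pi> e = \<top>\<^bsub>L\<^esub>"
      and other: "\<And>x. x \<in> X \<Longrightarrow> x \<in> S e \<Longrightarrow> x \<noteq> w \<Longrightarrow> x \<noteq> e \<Longrightarrow> \<pi> x = \<bottom>\<^bsub>L\<^esub>" for e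
  proof -
    have g: "(\<lambda>x. if x = w then u else if x = e then \<pi> e else \<bottom>\<^bsub>L\<^esub>) \<in> X \<rightarrow> carrier L"
      using e(3) by simp
    obtain \<rho> where \<rho>: "\<rho> \<in> bl_hom F L"
      "\<And>x. x \<in> X \<Longrightarrow> \<rho> x = (if x = w then u else if x = e then \<pi> e else \<bottom>\<^bsub>L\<^esub>)"
      by (rule free_hom[OF L g]) (rule that)
    have sub: "Y e \<subseteq> hom_kernel F \<rho>"
    proof (rule hom_kernel_complement[OF L _ e(3,4,5) ne w e(1) _ Y(1,2)[OF e(1)] \<rho>(1)])
      show "w \<noteq> e" using e(2) by blast
    qed (use e \<rho>(2) w in simp_all)
    have eq: "\<rho> r = \<pi> r" if r: "r \<in> carrier F" "supp r \<subseteq> S e" for r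
    proof (rule supp(3)[OF r(1) \<rho>(1) \<pi>(1)], rule ballI)
      fix x assume "x \<in> supp r"
      then have "x \<in> X" "x \<in> S e" using supp(1)[OF r(1)] r(2) by auto
      then show "\<rho> x = \<pi> x" using \<rho>(2)[of x] \<pi>(2)[OF w] other[of x] by simp
    qed
    show ?thesis
    proof (rule subrelI)
      fix p q assume pq: "(p, q) \<in> Y e"
      then have "p \<in> carrier F" "q \<in> carrier F" "\<rho> p = \<rho> q"
        using sub by (auto simp: hom_kernel_def)
      moreover have "supp p \<subseteq> S e" "supp q \<subseteq> S e" using pq by (auto simp: S_def)
      ultimately show "(p, q) \<in> hom_kernel F \<pi>" using eq by (simp add: hom_kernel_def)
    qed
  qed
  \<comment> \<open>For \<open>e = c\<close> the only other generator at which \<open>\<pi>\<close>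
    may be nonzero, apart from \<open>w\<close>, is \<open>d\<close>, and \<open>d\<close> is not in
    \<open>S c\<close>. The case \<open>e = d\<close> is symmetric.\<close>
  have "Y c \<subseteq> hom_kernel F \<pi>" "Y d \<subseteq> hom_kernel F \<pi>"
    by (rule key; use cd comp \<pi>(2) in auto)+
  then have "(c, d) \<in> hom_kernel F \<pi>"
    using Y(3)[OF _ _ hom_kernel_congruence[OF F_bounded \<pi>(1)]] cd by auto
  then show False using cd ab \<pi> by (auto simp: hom_kernel_def)
qed

end

section \<open>Compact congruences\<close>

lemma congruences_subset: "\<theta> \<in> congruences A \<Longrightarrow> \<theta> \<subseteq> alg_univ A \<times> alg_univ A"
  by (auto simp: congruences_def equiv_def)

lemma congruences_sym: "\<theta> \<in> congruences A \<Longrightarrow> (x, y) \<in> \<theta> \<Longrightarrow> (y, x) \<in> \<theta>"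
  by (auto simp: congruences_def equiv_def dest: symD)

lemma congruences_trans: "\<theta> \<in> congruences A \<Longrightarrow> (x, y) \<in> \<theta> \<Longrightarrow> (y, z) \<in> \<theta> \<Longrightarrow> (x, z) \<in> \<theta>"
  by (auto simp: congruences_def equiv_def dest: transD)

lemma congruences_refl: "\<theta> \<in> congruences A \<Longrightarrow> x \<in> alg_univ A \<Longrightarrow> (x, x) \<in> \<theta>"
  by (auto simp: congruences_def equiv_def refl_on_def)

lemma cong_gen_mono: "R \<subseteq> R' \<Longrightarrow> cong_gen A R \<subseteq> cong_gen A R'"
  by (auto simp: cong_gen_def)

text \<open>The supremum is defined as some least upper bound, so besides showing that the generated
  congruence is one, the proof also shows that it is the only one.\<close>

lemma Con_lat_sup:
  assumes A: "is_algebra A" and S: "S \<subseteq> congruences A"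
  shows "\<Squnion>\<^bsub>Con_lat A\<^esub>S = cong_gen A (\<Union>S)"
proof -
  have gen: "cong_gen A (\<Union>S) \<in> congruences A"
    by (rule cong_gen_in[OF A]) (use S congruences_subset in blast)
  have least: "least (Con_lat A) (cong_gen A (\<Union>S)) (Upper (Con_lat A) S)"
    unfolding least_def
  proof (intro conjI ballI)
    show "Upper (Con_lat A) S \<subseteq> carrier (Con_lat A)" by simp
    show "cong_gen A (\<Union>S) \<in> Upper (Con_lat A) S"
      using gen cong_gen_superset[of "\<Union>S" A] by (auto simp: Upper_def Con_lat_def)
    fix x assume "x \<in> Upper (Con_lat A) S"
    then have "x \<in> congruences A" "\<Union>S \<subseteq> x" using S by (auto simp: Upper_def Con_lat_def)
    then show "cong_gen A (\<Union>S) \<sqsubseteq>\<^bsub>Con_lat A\<^esub> x" by (simp add: Con_lat_def cong_gen_least)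
  qed
  show ?thesis
    unfolding sup_def
  proof (rule some_equality[of "\<lambda>x. least (Con_lat A) x (Upper (Con_lat A) S)", OF least])
    show "x = cong_gen A (\<Union>S)" if "least (Con_lat A) x (Upper (Con_lat A) S)" for x
      using that least by (auto simp: least_def Con_lat_def)
  qed
qed

lemma compact_congruence_iff:
  assumes "is_algebra A"
  shows "compact_element (Con_lat A) \<theta> \<longleftrightarrow> \<theta> \<in> congruences A \<and>
    (\<forall>S \<subseteq> congruences A. \<theta> \<subseteq> cong_gen A (\<Union>S) \<longrightarrow> (\<exists>T\<subseteq>S. finite T \<and> \<theta> \<subseteq> cong_gen A (\<Union>T)))"
proof -
  have carr: "carrier (Con_lat A) = congruences A" and le: "x \<sqsubseteq>\<^bsub>Con_lat A\<^esub> y \<longleftrightarrow> x \<subseteq> y" for x y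
    by (simp_all add: Con_lat_def)
  have eq: "(\<theta> \<subseteq> \<Squnion>\<^bsub>Con_lat A\<^esub>S \<longrightarrow> (\<exists>T\<subseteq>S. finite T \<and> \<theta> \<subseteq> \<Squnion>\<^bsub>Con_lat A\<^esub>T)) \<longleftrightarrow>
      (\<theta> \<subseteq> cong_gen A (\<Union>S) \<longrightarrow> (\<exists>T\<subseteq>S. finite T \<and> \<theta> \<subseteq> cong_gen A (\<Union>T)))"
    if S: "S \<subseteq> congruences A" for S
  proof -
    have "\<Squnion>\<^bsub>Con_lat A\<^esub>T = cong_gen A (\<Union>T)" if "T \<subseteq> S" for T
      using that S by (intro Con_lat_sup[OF assms]) (rule subset_trans)
    then show ?thesis by (simp cong: conj_cong)
  qed
  show ?thesis
    unfolding compact_element_def carr le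
    by (rule conj_cong[OF refl], rule all_cong1, rule imp_cong[OF refl], rule eq)
qed

text \<open>A congruence is the supremum of the principal congruences of its pairs, and compactness
  keeps finitely many of them.\<close>

lemma compact_congruence_finitely_generated:
  assumes A: "is_algebra A" and c: "compact_element (Con_lat A) \<theta>"
  obtains Y where "finite Y" "Y \<subseteq> \<theta>" "\<theta> = cong_gen A Y"
proof -
  have \<theta>: "\<theta> \<in> congruences A" using c by (simp add: compact_congruence_iff[OF A])
  let ?S = "(\<lambda>p. cong_gen A {p}) ` \<theta>"
  have "?S \<subseteq> congruences A"
    using cong_gen_in[OF A] congruences_subset[OF \<theta>] by blast
  moreover have "\<theta> \<subseteq> \<Union>?S" using cong_gen_superset by fastforce
  then have "\<theta> \<subseteq> cong_gen A (\<Union>?S)" using cong_gen_superset by (rule subset_trans)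
  ultimately obtain T where T: "T \<subseteq> ?S" "finite T" "\<theta> \<subseteq> cong_gen A (\<Union>T)"
    using c unfolding compact_congruence_iff[OF A] by meson
  obtain Y where Y: "Y \<subseteq> \<theta>" "finite Y" "T = (\<lambda>p. cong_gen A {p}) ` Y"
    using finite_subset_image[OF T(2,1)] by blast
  have "cong_gen A Y \<in> congruences A"
    using Y(1) congruences_subset[OF \<theta>] by (intro cong_gen_in[OF A]) blast
  moreover have "\<Union>T \<subseteq> cong_gen A Y" using cong_gen_mono[of "{_}" Y A] Y(3) by blast
  ultimately have "cong_gen A (\<Union>T) \<subseteq> cong_gen A Y" by (rule cong_gen_least)
  then have "\<theta> = cong_gen A Y" using T(3) cong_gen_least[OF \<theta> Y(1)] by blast
  then show ?thesis using that Y by blast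
qed

text \<open>The join is a least upper bound among compact congruences only. It agrees with the
  generated congruence because that one is again compact: finite subfamilies covering
  \<open>\<alpha>\<close> and \<open>\<beta>\<close> are united.\<close>

lemma Con_c_join:
  assumes A: "is_algebra A" and "\<alpha> \<in> carrier (Con_c A)" "\<beta> \<in> carrier (Con_c A)"
  shows "\<alpha> \<squnion>\<^bsub>Con_c A\<^esub> \<beta> = cong_gen A (\<alpha> \<union> \<beta>)"
proof -
  have carr: "carrier (Con_c A) = {\<theta>. compact_element (Con_lat A) \<theta>}"
    and le: "x \<sqsubseteq>\<^bsub>Con_c A\<^esub> y \<longleftrightarrow> x \<subseteq> y" for x y
    by (simp_all add: Con_c_def)
  have c: "compact_element (Con_lat A) \<alpha>" "compact_element (Con_lat A) \<beta>"
    using assms(2,3) carr by auto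
  then have con: "\<alpha> \<in> congruences A" "\<beta> \<in> congruences A"
    by (simp_all add: compact_congruence_iff[OF A])
  let ?g = "cong_gen A (\<alpha> \<union> \<beta>)"
  have g: "?g \<in> congruences A"
    using congruences_subset[OF con(1)] congruences_subset[OF con(2)] by (intro cong_gen_in[OF A]) blast
  have "compact_element (Con_lat A) ?g"
    unfolding compact_congruence_iff[OF A]
  proof (intro conjI g allI impI)
    fix S assume S: "S \<subseteq> congruences A" and le: "?g \<subseteq> cong_gen A (\<Union>S)"
    then have "\<alpha> \<subseteq> cong_gen A (\<Union>S)" "\<beta> \<subseteq> cong_gen A (\<Union>S)"
      using cong_gen_superset[of "\<alpha> \<union> \<beta>" A] by blast+
    then obtain T U where T: "T \<subseteq> S" "finite T" "\<alpha> \<subseteq> cong_gen A (\<Union>T)"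
      and U: "U \<subseteq> S" "finite U" "\<beta> \<subseteq> cong_gen A (\<Union>U)"
      using c S unfolding compact_congruence_iff[OF A] by meson
    have "cong_gen A (\<Union>(T \<union> U)) \<in> congruences A"
      using S T(1) U(1) congruences_subset by (intro cong_gen_in[OF A]) blast
    moreover have "\<alpha> \<union> \<beta> \<subseteq> cong_gen A (\<Union>(T \<union> U))"
      using T(3) U(3) cong_gen_mono[of "\<Union>T" "\<Union>(T \<union> U)" A] cong_gen_mono[of "\<Union>U" "\<Union>(T \<union> U)" A]
      by blast
    ultimately have "?g \<subseteq> cong_gen A (\<Union>(T \<union> U))" by (rule cong_gen_least)
    then show "\<exists>T\<subseteq>S. finite T \<and> ?g \<subseteq> cong_gen A (\<Union>T)"
      using T U by (intro exI[of _ "T \<union> U"]) simp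
  qed
  then have upper: "?g \<in> Upper (Con_c A) {\<alpha>, \<beta>}"
    using cong_gen_superset[of "\<alpha> \<union> \<beta>" A] by (auto simp: Upper_def carr le)
  have "?g \<subseteq> \<theta>" if "\<theta> \<in> Upper (Con_c A) {\<alpha>, \<beta>}" for \<theta>
  proof (rule cong_gen_least)
    show "\<theta> \<in> congruences A" using that by (simp add: Upper_def carr compact_congruence_iff[OF A])
    show "\<alpha> \<union> \<beta> \<subseteq> \<theta>" using that c by (simp add: Upper_def carr le)
  qed
  with upper have least: "least (Con_c A) ?g (Upper (Con_c A) {\<alpha>, \<beta>})"
    by (simp add: least_def le)
  show ?thesis
    unfolding join_def sup_def
  proof (rule some_equality[of "\<lambda>x. least (Con_c A) x (Upper (Con_c A) {\<alpha>, \<beta>})", OF least])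
    show "x = ?g" if "least (Con_c A) x (Upper (Con_c A) {\<alpha>, \<beta>})" for x
    proof -
      have x: "x \<in> Upper (Con_c A) {\<alpha>, \<beta>}" and least_x: "\<forall>y\<in>Upper (Con_c A) {\<alpha>, \<beta>}. x \<subseteq> y"
        using that unfolding least_def le by - (elim conjE; assumption)+
      have "\<forall>y\<in>Upper (Con_c A) {\<alpha>, \<beta>}. ?g \<subseteq> y"
        using least unfolding least_def le by (elim conjE)
      from bspec[OF least_x upper] bspec[OF this x] show ?thesis by (rule equalityI)
    qed
  qed
qed

text \<open>Operations take finitely many arguments, so the union \<open>\<beta>\<close> of the
  congruences generated by finite parts of \<open>R\<close> is already a congruence containing
  \<open>R\<close>.\<close>

lemma cong_gen_finitary:
  assumes B: "is_algebra B" and R: "R \<subseteq> alg_univ B \<times> alg_univ B" and p: "p \<in> cong_gen B R"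
  obtains Y where "finite Y" "Y \<subseteq> R" "p \<in> cong_gen B Y"
proof -
  define \<beta> where "\<beta> = {p. \<exists>Y\<subseteq>R. finite Y \<and> p \<in> cong_gen B Y}"
  have gen: "cong_gen B Y \<in> congruences B" if "Y \<subseteq> R" for Y
    using cong_gen_in[OF B] that R by blast
  have "\<beta> \<in> congruences B"
  proof (rule congruencesI)
    show "equiv (alg_univ B) \<beta>"
    proof (rule equivI)
      show "\<beta> \<subseteq> alg_univ B \<times> alg_univ B"
        using congruences_subset[OF gen] unfolding \<beta>_def by blast
      show "refl_on (alg_univ B) \<beta>"
        using congruences_refl[OF gen[of "{}"]] unfolding \<beta>_def refl_on_def by blast
      show "sym \<beta>"
        using congruences_sym[OF gen] unfolding \<beta>_def sym_def by blast
      show "trans \<beta>"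
      proof (rule transI)
        fix x y z assume "(x, y) \<in> \<beta>" "(y, z) \<in> \<beta>"
        then obtain Y Z where YZ: "Y \<union> Z \<subseteq> R" "finite (Y \<union> Z)"
          and "(x, y) \<in> cong_gen B Y" "(y, z) \<in> cong_gen B Z"
          unfolding \<beta>_def by auto
        then have "(x, y) \<in> cong_gen B (Y \<union> Z)" "(y, z) \<in> cong_gen B (Y \<union> Z)"
          using cong_gen_mono[of Y "Y \<union> Z" B] cong_gen_mono[of Z "Y \<union> Z" B] by auto
        then have "(x, z) \<in> cong_gen B (Y \<union> Z)" by (rule congruences_trans[OF gen[OF YZ(1)]])
        then show "(x, z) \<in> \<beta>" using YZ unfolding \<beta>_def by blast
      qed
    qed
  next
    fix f xs ys assume f: "f \<in> alg_lang B" "length xs = alg_arity B f"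
      and r: "list_all2 (\<lambda>x y. (x, y) \<in> \<beta>) xs ys"
    \<comment> \<open>Each pair of arguments comes with its own finite set; induction along the
      lists unites these into one set that serves all arguments.\<close>
    from r have "\<exists>Y\<subseteq>R. finite Y \<and> list_all2 (\<lambda>x y. (x, y) \<in> cong_gen B Y) xs ys"
    proof (induction rule: list_all2_induct)
      case Nil
      then show ?case by (intro exI[of _ "{}"]) simp
    next
      case (Cons x xs y ys)
      then obtain Y Z where YZ: "Y \<subseteq> R" "finite Y" "Z \<subseteq> R" "finite Z" "(x, y) \<in> cong_gen B Y"
        and r: "list_all2 (\<lambda>x y. (x, y) \<in> cong_gen B Z) xs ys"
        unfolding \<beta>_def by blast
      have "(x, y) \<in> cong_gen B (Y \<union> Z)" using YZ(5) cong_gen_mono[of Y "Y \<union> Z" B] by auto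
      moreover have "list_all2 (\<lambda>x y. (x, y) \<in> cong_gen B (Y \<union> Z)) xs ys"
        using r cong_gen_mono[of Z "Y \<union> Z" B] by (elim list_all2_mono) auto
      ultimately show ?case using YZ by (intro exI[of _ "Y \<union> Z"]) simp
    qed
    then obtain Y where Y: "Y \<subseteq> R" "finite Y" "list_all2 (\<lambda>x y. (x, y) \<in> cong_gen B Y) xs ys"
      by blast
    then have "(alg_op B f xs, alg_op B f ys) \<in> cong_gen B Y"
      using gen[OF Y(1)] f by (simp add: congruences_def)
    then show "(alg_op B f xs, alg_op B f ys) \<in> \<beta>" using Y unfolding \<beta>_def by blast
  qed
  moreover have "R \<subseteq> \<beta>"
  proof
    fix q assume "q \<in> R"
    moreover have "q \<in> cong_gen B {q}" using cong_gen_superset[of "{q}" B] by blast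
    ultimately show "q \<in> \<beta>" unfolding \<beta>_def by (intro CollectI exI[of _ "{q}"]) simp
  qed
  ultimately have "p \<in> \<beta>" using p cong_gen_least by blast
  then show ?thesis using that unfolding \<beta>_def by blast
qed

section \<open>Retracts and extensions\<close>

lemma cp_extensionD:
  assumes "cp_extension A B"
  shows "is_algebra A" "is_algebra B" "alg_univ A \<subseteq> alg_univ B" "alg_lang A \<subseteq> alg_lang B"
    "\<forall>f\<in>alg_lang A. alg_arity B f = alg_arity A f \<and>
        (\<forall>xs\<in>lists (alg_univ A). length xs = alg_arity A f \<longrightarrow> alg_op B f xs = alg_op A f xs)"
    "\<forall>\<alpha>\<in>congruences A. \<exists>!\<beta>. \<beta> \<in> congruences B \<and> \<beta> \<inter> (alg_univ A \<times> alg_univ A) = \<alpha>"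
  using assms unfolding cp_extension_def by - (elim conjE; assumption)+

lemma cp_extension_unique:
  assumes "cp_extension A B" "\<beta> \<in> congruences B" "\<gamma> \<in> congruences B"
    and eq: "\<beta> \<inter> (alg_univ A \<times> alg_univ A) = \<gamma> \<inter> (alg_univ A \<times> alg_univ A)"
  shows "\<beta> = \<gamma>"
proof -
  let ?res = "\<lambda>\<theta>. \<theta> \<inter> (alg_univ A \<times> alg_univ A)"
  have "?res \<gamma> \<in> congruences A"
    by (rule congruences_restrict[OF cp_extensionD(1,3,4,5)[OF assms(1)] assms(3)])
  with cp_extensionD(6)[OF assms(1)]
  have "\<exists>!\<beta>. \<beta> \<in> congruences B \<and> ?res \<beta> = ?res \<gamma>" by (rule bspec)
  then show ?thesis
  proof (rule ex1E)
    fix \<delta> assume *: "\<forall>\<epsilon>. \<epsilon> \<in> congruences B \<and> ?res \<epsilon> = ?res \<gamma> \<longrightarrow> \<epsilon> = \<delta>"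
    have "\<beta> = \<delta>" using *[THEN spec, of \<beta>] assms(2) eq by simp
    moreover have "\<gamma> = \<delta>" using *[THEN spec, of \<gamma>] assms(3) by simp
    ultimately show ?thesis by simp
  qed
qed

text \<open>The generated congruence lies between \<open>\<psi>\<close> and its extension
  \<open>\<beta>\<close>, and the trace of \<open>\<beta>\<close> on \<open>A\<close> is
  \<open>\<psi>\<close>.\<close>

lemma cp_extension_congruence:
  assumes ext: "cp_extension A B" and \<psi>: "\<psi> \<in> congruences A"
  shows "cong_gen B \<psi> \<in> congruences B" "cong_gen B \<psi> \<inter> (alg_univ A \<times> alg_univ A) = \<psi>"
proof -
  note B = cp_extensionD(2)[OF ext] and sub = cp_extensionD(3)[OF ext]
  obtain \<beta> where \<beta>: "\<beta> \<in> congruences B" "\<beta> \<inter> (alg_univ A \<times> alg_univ A) = \<psi>"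
    using bspec[OF cp_extensionD(6)[OF ext] \<psi>] by blast
  have "\<psi> \<subseteq> alg_univ B \<times> alg_univ B" using congruences_subset[OF \<psi>] sub by blast
  then show "cong_gen B \<psi> \<in> congruences B" by (rule cong_gen_in[OF B])
  have "cong_gen B \<psi> \<subseteq> \<beta>" using \<beta> by (intro cong_gen_least) auto
  then show "cong_gen B \<psi> \<inter> (alg_univ A \<times> alg_univ A) = \<psi>"
    using \<beta>(2) cong_gen_superset[of \<psi> B] congruences_subset[OF \<psi>] by blast
qed

text \<open>\<open>\<theta>\<close> and the congruence generated by its trace have the same trace on
  \<open>A\<close>, so uniqueness of extensions identifies them.\<close>

lemma cp_extension_restrict_generates:
  assumes ext: "cp_extension A B" and \<theta>: "\<theta> \<in> congruences B"
  shows "cong_gen B (\<theta> \<inter> (alg_univ A \<times> alg_univ A)) = \<theta>"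
proof -
  let ?\<alpha> = "\<theta> \<inter> (alg_univ A \<times> alg_univ A)"
  note B = cp_extensionD(2)[OF ext]
  have 1: "\<theta> \<subseteq> alg_univ B \<times> alg_univ B" by (rule congruences_subset[OF \<theta>])
  have 2: "?\<alpha> \<subseteq> alg_univ B \<times> alg_univ B" by (rule subset_trans[OF Int_lower1 1])
  have gen: "cong_gen B ?\<alpha> \<in> congruences B" by (rule cong_gen_in[OF B 2])
  have "cong_gen B ?\<alpha> \<subseteq> \<theta>" by (rule cong_gen_least[OF \<theta> Int_lower1])
  then have "cong_gen B ?\<alpha> \<inter> (alg_univ A \<times> alg_univ A) = ?\<alpha>"
    using cong_gen_superset[of ?\<alpha> B] by blast
  then show ?thesis by (rule cp_extension_unique[OF ext gen \<theta>])
qed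

text \<open>The pair \<open>(t, c)\<close> may involve new elements, but its principal congruence is
  generated by its trace on \<open>A\<close>, and finitely many pairs of the trace already produce
  \<open>(t, c)\<close>. This brings the distance from \<open>t\<close> to \<open>c\<close> back to
  finitely many pairs in \<open>A\<close>.\<close>

lemma cp_extension_principal_generated:
  assumes ext: "cp_extension A B" and tc: "t \<in> alg_univ B" "c \<in> alg_univ B"
  obtains Y where "finite Y" "Y \<subseteq> alg_univ A \<times> alg_univ A" "principal_cong B t c = cong_gen B Y"
proof -
  note B = cp_extensionD(2)[OF ext]
  let ?\<theta> = "principal_cong B t c"
  have \<theta>: "?\<theta> \<in> congruences B" unfolding principal_cong_def by (rule cong_gen_in[OF B]) (use tc in simp)
  have "(t, c) \<in> cong_gen B (?\<theta> \<inter> (alg_univ A \<times> alg_univ A))"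
    unfolding cp_extension_restrict_generates[OF ext \<theta>]
    using cong_gen_superset[of "{(t, c)}" B] by (simp add: principal_cong_def)
  then obtain Y where Y: "finite Y" "Y \<subseteq> ?\<theta> \<inter> (alg_univ A \<times> alg_univ A)" "(t, c) \<in> cong_gen B Y"
    by (rule cong_gen_finitary[OF B le_infI1[OF congruences_subset[OF \<theta>]]])
  have Y_\<theta>: "Y \<subseteq> ?\<theta>" using Y(2) by (rule subset_trans) (rule Int_lower1)
  have gY: "cong_gen B Y \<in> congruences B"
    by (rule cong_gen_in[OF B subset_trans[OF Y_\<theta> congruences_subset[OF \<theta>]]])
  have "cong_gen B Y \<subseteq> ?\<theta>" by (rule cong_gen_least[OF \<theta> Y_\<theta>])
  moreover have "?\<theta> \<subseteq> cong_gen B Y"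
    unfolding principal_cong_def by (rule cong_gen_least[OF gY]) (use Y(3) in simp)
  ultimately have "?\<theta> = cong_gen B Y" by blast
  then show ?thesis using that Y by blast
qed

text \<open>The argument runs inside \<open>B\<close>, with the principal congruence of
  \<open>(t, c)\<close> as the distance from \<open>t\<close> to a generator \<open>c\<close>. Each
  congruence \<open>\<psi>\<close> of \<open>F\<close> is replaced by
  \<open>cong_gen B \<psi>\<close>, where the elements related to \<open>t\<close> can be
  compared.\<close>

lemma free_no_cpcp_extension:
  fixes F :: "'a gorder"
  assumes free: "free_bounded_lattice E F X" and nd: "nondistributive_variety TYPE('n) E"
    and X: "uncountable X"
  shows "\<not> cpcp_extension (bl_algebra F :: ('e bl_symbol, 'a) alg) B"
proof
  let ?A = "bl_algebra F :: ('e bl_symbol, 'a) alg"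
  assume "cpcp_extension ?A B"
  then have ext: "cp_extension ?A B" and cp: "\<And>x y z. x \<in> carrier F \<Longrightarrow> y \<in> carrier F \<Longrightarrow> z \<in> carrier F \<Longrightarrow>
      \<exists>t\<in>alg_univ B. (x, t) \<in> principal_cong B y z \<and> (t, z) \<in> principal_cong B x y"
    unfolding cpcp_extension_def by auto
  interpret F: bounded_lattice F using F_bounded[OF free] .
  have sub: "carrier F \<subseteq> alg_univ B" using cp_extensionD(3)[OF ext] by simp
  have XF: "X \<subseteq> carrier F" using X_F[OF free] .
  obtain w where w: "w \<in> X" using X by fastforce
  \<comment> \<open>The CPCP condition for the triple \<open>\<bottom>\<close>, \<open>w\<close>,
    \<open>\<top>\<close>: \<open>t\<close> becomes \<open>\<bottom>\<close> where \<open>w\<close>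
    becomes \<open>\<top>\<close>, and \<open>\<top>\<close> where \<open>w\<close> becomes
    \<open>\<bottom>\<close>, as a complement of \<open>w\<close> would.\<close>
  then obtain t where t: "t \<in> alg_univ B" "(\<bottom>\<^bsub>F\<^esub>, t) \<in> principal_cong B w \<top>\<^bsub>F\<^esub>"
      "(t, \<top>\<^bsub>F\<^esub>) \<in> principal_cong B \<bottom>\<^bsub>F\<^esub> w"
    using cp[of "\<bottom>\<^bsub>F\<^esub>" w "\<top>\<^bsub>F\<^esub>"] XF by auto
  have "\<forall>c\<in>X. \<exists>Y. finite Y \<and> Y \<subseteq> carrier F \<times> carrier F \<and> principal_cong B t c = cong_gen B Y"
  proof
    fix c assume "c \<in> X"
    then have "c \<in> alg_univ B" using XF sub by auto
    then obtain Y where "finite Y" "Y \<subseteq> alg_univ ?A \<times> alg_univ ?A" "principal_cong B t c = cong_gen B Y"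
      by (rule cp_extension_principal_generated[OF ext t(1)])
    then show "\<exists>Y. finite Y \<and> Y \<subseteq> carrier F \<times> carrier F \<and> principal_cong B t c = cong_gen B Y"
      by (intro exI[of _ Y]) simp
  qed
  then obtain Y where Y_all: "\<forall>c\<in>X. finite (Y c) \<and> Y c \<subseteq> carrier F \<times> carrier F \<and> principal_cong B t c = cong_gen B (Y c)"
    by (rule bchoice[THEN exE])
  then have fin: "\<And>c. c \<in> X \<Longrightarrow> finite (Y c)"
    and YF: "\<And>c. c \<in> X \<Longrightarrow> Y c \<subseteq> carrier F \<times> carrier F"
    and Y: "\<And>c. c \<in> X \<Longrightarrow> principal_cong B t c = cong_gen B (Y c)" by simp_all
  \<comment> \<open>This translates between \<open>F\<close> and \<open>B\<close>: the finite set
    \<open>Y c\<close> is collapsed by \<open>\<psi>\<close> exactly when the extension of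
    \<open>\<psi>\<close> identifies \<open>t\<close> with \<open>c\<close>.\<close>
  have Y_sub: "Y c \<subseteq> \<psi> \<longleftrightarrow> (t, c) \<in> cong_gen B \<psi>" if c: "c \<in> X" and \<psi>: "\<psi> \<in> congruences ?A" for c \<psi>
  proof
    note e = cp_extension_congruence[OF ext \<psi>]
    assume "(t, c) \<in> cong_gen B \<psi>"
    then have "principal_cong B t c \<subseteq> cong_gen B \<psi>"
      unfolding principal_cong_def by (intro cong_gen_least[OF e(1)]) simp
    then have "Y c \<subseteq> cong_gen B \<psi>" using Y[OF c] cong_gen_superset[of "Y c" B] by blast
    then show "Y c \<subseteq> \<psi>" using e(2) YF[OF c] by auto
  next
    assume "Y c \<subseteq> \<psi>"
    then show "(t, c) \<in> cong_gen B \<psi>"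
      using cong_gen_mono[of "Y c" \<psi> B] Y[OF c] cong_gen_superset[of "{(t, c)}" B]
      by (auto simp: principal_cong_def)
  qed
  have pr: "principal_cong B x y \<subseteq> cong_gen B \<psi>" if "(x, y) \<in> \<psi>" "\<psi> \<in> congruences ?A" for x y \<psi>
    using that cong_gen_mono[of "{(x, y)}" \<psi> B] by (simp add: principal_cong_def)
  show False
  proof (rule no_complement_family[OF free nd X w fin YF])
    fix c \<psi> assume c: "c \<in> X" and \<psi>: "\<psi> \<in> congruences ?A"
    note con = cp_extension_congruence(1)[OF ext \<psi>]
    have sup: "\<psi> \<subseteq> cong_gen B \<psi>" by (rule cong_gen_superset)
    {
      assume "(\<bottom>\<^bsub>F\<^esub>, w) \<in> \<psi>" "(\<top>\<^bsub>F\<^esub>, c) \<in> \<psi>"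
      then have "(t, \<top>\<^bsub>F\<^esub>) \<in> cong_gen B \<psi>" "(\<top>\<^bsub>F\<^esub>, c) \<in> cong_gen B \<psi>"
        using pr[OF _ \<psi>] t(3) sup by blast+
      then show "Y c \<subseteq> \<psi>"
        unfolding Y_sub[OF c \<psi>] by (rule congruences_trans[OF con])
    next
      assume "(w, \<top>\<^bsub>F\<^esub>) \<in> \<psi>" "(\<bottom>\<^bsub>F\<^esub>, c) \<in> \<psi>"
      then have "(\<bottom>\<^bsub>F\<^esub>, t) \<in> cong_gen B \<psi>" "(\<bottom>\<^bsub>F\<^esub>, c) \<in> cong_gen B \<psi>"
        using pr[OF _ \<psi>] t(2) sup by blast+
      then show "Y c \<subseteq> \<psi>"
        unfolding Y_sub[OF c \<psi>] by (blast intro: congruences_trans[OF con] congruences_sym[OF con])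
    next
      fix d assume d: "d \<in> X" and "Y c \<subseteq> \<psi>" "Y d \<subseteq> \<psi>"
      then have "(t, c) \<in> cong_gen B \<psi>" "(t, d) \<in> cong_gen B \<psi>"
        using Y_sub[OF c \<psi>] Y_sub[OF d \<psi>] by blast+
      then have "(c, d) \<in> cong_gen B \<psi>"
        by (blast intro: congruences_trans[OF con] congruences_sym[OF con])
      then show "(c, d) \<in> \<psi>" using cp_extension_congruence(2)[OF ext \<psi>] c d XF by auto
    }
  qed
qed

text \<open>The point \<open>t\<close> may lie outside the core, where \<open>f\<close> gives no
  information, but its distances still have images under \<open>f'\<close>. So \<open>D\<close>
  behaves as a distance with values in the compact congruences of \<open>F\<close> on all points of
  the cover, and \<open>D t (s c)\<close> is the congruence attached to \<open>c\<close>.\<close>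

lemma free_not_cpcp_retract:
  fixes F :: "'a gorder"
  assumes free: "free_bounded_lattice E F X" and nd: "nondistributive_variety TYPE('n) E"
    and X: "uncountable X"
  shows "\<not> cpcp_retract TYPE('b) TYPE('t) (alg_natural (bl_algebra F :: ('e bl_symbol, 'a) alg))"
proof
  let ?A = "bl_algebra F :: ('e bl_symbol, 'a) alg"
  interpret F: bounded_lattice F using F_bounded[OF free] .
  have A: "is_algebra ?A" using is_algebra_bl_algebra[OF F_bounded[OF free]] .
  assume "cpcp_retract TYPE('b) TYPE('t) (alg_natural ?A)"
  then obtain B :: "('b, 't) sm_cover" and f f' where cover: "semilattice_metric_cover B"
    and da: "double_arrow (sm_flat B) (alg_natural ?A) f f'" unfolding cpcp_retract_def by blast
  let ?S = "sm_vals B" and ?\<delta> = "sm_dist B" and ?P = "sm_points B"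
  have space: "semilattice_metric_space B" and core: "sm_core B \<subseteq> ?P"
    and cov: "\<And>x y z. x \<in> sm_core B \<Longrightarrow> y \<in> sm_core B \<Longrightarrow> z \<in> sm_core B \<Longrightarrow>
      \<exists>t\<in>?P. ?\<delta> x t \<sqsubseteq>\<^bsub>?S\<^esub> ?\<delta> y z \<and> ?\<delta> t z \<sqsubseteq>\<^bsub>?S\<^esub> ?\<delta> x y"
    using cover unfolding semilattice_metric_cover_def by blast+
  have "upper_semilattice ?S" using space by (simp add: semilattice_metric_space_def join0_semilattice_def)
  then interpret S: upper_semilattice ?S .
  have dist: "\<And>x y. x \<in> ?P \<Longrightarrow> y \<in> ?P \<Longrightarrow> ?\<delta> x y \<in> carrier ?S"
    and dist_sym: "\<And>x y. x \<in> ?P \<Longrightarrow> y \<in> ?P \<Longrightarrow> ?\<delta> x y = ?\<delta> y x"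
    and tri: "\<And>x y z. x \<in> ?P \<Longrightarrow> y \<in> ?P \<Longrightarrow> z \<in> ?P \<Longrightarrow> ?\<delta> x z \<sqsubseteq>\<^bsub>?S\<^esub> ?\<delta> x y \<squnion>\<^bsub>?S\<^esub> ?\<delta> y z"
    using space unfolding semilattice_metric_space_def by blast+
  have onto: "f ` sm_core B = carrier F"
    and f'C: "\<And>p. p \<in> carrier ?S \<Longrightarrow> f' p \<in> carrier (Con_c ?A)"
    and f'J: "\<And>p q. p \<in> carrier ?S \<Longrightarrow> q \<in> carrier ?S \<Longrightarrow> f' (p \<squnion>\<^bsub>?S\<^esub> q) = f' p \<squnion>\<^bsub>Con_c ?A\<^esub> f' q"
    and f'D: "\<And>x y. x \<in> sm_core B \<Longrightarrow> y \<in> sm_core B \<Longrightarrow> principal_cong ?A (f x) (f y) = f' (?\<delta> x y)"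
    using da by (auto simp: double_arrow_def sm_morphism_def sm_flat_def alg_natural_def join0_hom_def)
  have f'_join: "f' (p \<squnion>\<^bsub>?S\<^esub> q) = cong_gen ?A (f' p \<union> f' q)" if "p \<in> carrier ?S" "q \<in> carrier ?S" for p q
    using f'J[OF that] Con_c_join[OF A f'C f'C] that by simp
  \<comment> \<open>Preservation of joins gives monotonicity, because
    \<open>p \<sqsubseteq> q\<close> amounts to \<open>p \<squnion> q = q\<close>.\<close>
  have f'_mono: "f' p \<subseteq> f' q" if pq: "p \<in> carrier ?S" "q \<in> carrier ?S" "p \<sqsubseteq>\<^bsub>?S\<^esub> q" for p q
  proof -
    have "p \<squnion>\<^bsub>?S\<^esub> q = q"
      by (rule S.le_antisym) (use pq in \<open>simp_all add: S.join_le S.join_right\<close>)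
    then show ?thesis
      using f'_join[OF pq(1,2)] cong_gen_superset[of "f' p \<union> f' q" ?A] by auto
  qed
  define D where "D x y = f' (?\<delta> x y)" for x y
  have D_tri: "D x z \<subseteq> \<psi>" if "x \<in> ?P" "y \<in> ?P" "z \<in> ?P" "D x y \<subseteq> \<psi>" "D y z \<subseteq> \<psi>" "\<psi> \<in> congruences ?A" for x y z \<psi>
  proof -
    have "D x z \<subseteq> f' (?\<delta> x y \<squnion>\<^bsub>?S\<^esub> ?\<delta> y z)"
      unfolding D_def by (rule f'_mono) (use that dist tri in simp_all)
    also have "\<dots> = cong_gen ?A (D x y \<union> D y z)"
      unfolding D_def by (rule f'_join) (use that dist in simp_all)
    also have "\<dots> \<subseteq> \<psi>" by (rule cong_gen_least) (use that in auto)
    finally show ?thesis .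
  qed
  \<comment> \<open>Surjectivity of the double arrow provides a section \<open>s\<close> of
    \<open>f\<close>, which lifts elements of \<open>F\<close> into the core, where the cover
    condition applies.\<close>
  obtain s where s: "\<And>x. x \<in> carrier F \<Longrightarrow> s x \<in> sm_core B" "\<And>x. x \<in> carrier F \<Longrightarrow> f (s x) = x"
    using onto by (metis f_inv_into_f inv_into_into)
  have sP: "\<And>x. x \<in> carrier F \<Longrightarrow> s x \<in> ?P" using s(1) core by blast
  have D_prin: "D (s x) (s y) = principal_cong ?A x y" if "x \<in> carrier F" "y \<in> carrier F" for x y
    using f'D[OF s(1) s(1)] s(2) that by (simp add: D_def)
  have XF: "X \<subseteq> carrier F" using X_F[OF free] .
  obtain w where w: "w \<in> X" using X by fastforce
  then have wF [simp]: "w \<in> carrier F" using XF by blast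
  obtain t where t: "t \<in> ?P" "?\<delta> (s \<bottom>\<^bsub>F\<^esub>) t \<sqsubseteq>\<^bsub>?S\<^esub> ?\<delta> (s w) (s \<top>\<^bsub>F\<^esub>)"
      "?\<delta> t (s \<top>\<^bsub>F\<^esub>) \<sqsubseteq>\<^bsub>?S\<^esub> ?\<delta> (s \<bottom>\<^bsub>F\<^esub>) (s w)"
    using cov[of "s \<bottom>\<^bsub>F\<^esub>" "s w" "s \<top>\<^bsub>F\<^esub>"] s(1) by auto
  have D_sym: "D x y = D y x" if "x \<in> ?P" "y \<in> ?P" for x y
    using dist_sym[OF that] by (simp add: D_def)
  have Dt: "D t (s \<bottom>\<^bsub>F\<^esub>) \<subseteq> principal_cong ?A w \<top>\<^bsub>F\<^esub>" "D t (s \<top>\<^bsub>F\<^esub>) \<subseteq> principal_cong ?A \<bottom>\<^bsub>F\<^esub> w"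
  proof -
    have "D (s \<bottom>\<^bsub>F\<^esub>) t \<subseteq> D (s w) (s \<top>\<^bsub>F\<^esub>)" "D t (s \<top>\<^bsub>F\<^esub>) \<subseteq> D (s \<bottom>\<^bsub>F\<^esub>) (s w)"
      unfolding D_def by (rule f'_mono; use t dist sP in simp)+
    then show "D t (s \<bottom>\<^bsub>F\<^esub>) \<subseteq> principal_cong ?A w \<top>\<^bsub>F\<^esub>" "D t (s \<top>\<^bsub>F\<^esub>) \<subseteq> principal_cong ?A \<bottom>\<^bsub>F\<^esub> w"
      using D_sym[OF t(1) sP[of "\<bottom>\<^bsub>F\<^esub>"]] by (simp_all add: D_prin)
  qed
  have pr: "principal_cong ?A x y \<subseteq> \<psi> \<longleftrightarrow> (x, y) \<in> \<psi>" if "\<psi> \<in> congruences ?A" for x y \<psi>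
    using cong_gen_least[OF that, of "{(x, y)}"] cong_gen_superset[of "{(x, y)}" ?A]
    by (auto simp: principal_cong_def)
  \<comment> \<open>The values of \<open>f'\<close> are compact congruences; this is the source of
    the finite generating sets.\<close>
  have "\<forall>c\<in>X. \<exists>Y. finite Y \<and> Y \<subseteq> carrier F \<times> carrier F \<and> D t (s c) = cong_gen ?A Y"
  proof
    fix c assume "c \<in> X"
    then have "D t (s c) \<in> carrier (Con_c ?A)"
      unfolding D_def using XF by (intro f'C dist t sP) auto
    then have comp: "compact_element (Con_lat ?A) (D t (s c))" by (simp add: Con_c_def)
    then have "D t (s c) \<subseteq> carrier F \<times> carrier F"
      using congruences_subset[of "D t (s c)" ?A] by (simp add: compact_congruence_iff[OF A])
    moreover obtain Y where "finite Y" "Y \<subseteq> D t (s c)" "D t (s c) = cong_gen ?A Y"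
      by (rule compact_congruence_finitely_generated[OF A comp])
    ultimately show "\<exists>Y. finite Y \<and> Y \<subseteq> carrier F \<times> carrier F \<and> D t (s c) = cong_gen ?A Y"
      by (intro exI[of _ Y]) simp
  qed
  then obtain Y where Y_all: "\<forall>c\<in>X. finite (Y c) \<and> Y c \<subseteq> carrier F \<times> carrier F \<and> D t (s c) = cong_gen ?A (Y c)"
    by (rule bchoice[THEN exE])
  then have fin: "\<And>c. c \<in> X \<Longrightarrow> finite (Y c)"
    and YF: "\<And>c. c \<in> X \<Longrightarrow> Y c \<subseteq> carrier F \<times> carrier F"
    and Y: "\<And>c. c \<in> X \<Longrightarrow> D t (s c) = cong_gen ?A (Y c)" by simp_all
  have Y_sub: "Y c \<subseteq> \<psi> \<longleftrightarrow> D t (s c) \<subseteq> \<psi>" if "c \<in> X" "\<psi> \<in> congruences ?A" for c \<psi>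
    using Y[OF that(1)] cong_gen_superset[of "Y c" ?A] cong_gen_least[OF that(2), of "Y c"] by blast
  show False
  \<comment> \<open>The three conditions come from the triangle inequality along \<open>t\<close>,
    \<open>s \<top>\<close>, \<open>s c\<close>, then along \<open>t\<close>,
    \<open>s \<bottom>\<close>, \<open>s c\<close>, and finally along \<open>s c\<close>,
    \<open>t\<close>, \<open>s d\<close>.\<close>
  proof (rule no_complement_family[OF free nd X w fin YF])
    fix c \<psi> assume c: "c \<in> X" and \<psi>: "\<psi> \<in> congruences ?A"
    then have cF: "c \<in> carrier F" using XF by blast
    {
      assume *: "(\<bottom>\<^bsub>F\<^esub>, w) \<in> \<psi>" "(\<top>\<^bsub>F\<^esub>, c) \<in> \<psi>"
      show "Y c \<subseteq> \<psi>"
        unfolding Y_sub[OF c \<psi>]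
        by (rule D_tri[OF t(1) sP[of "\<top>\<^bsub>F\<^esub>"] sP[OF cF] _ _ \<psi>])
           (use * Dt(2) cF pr[OF \<psi>] in \<open>auto simp: D_prin\<close>)
    next
      assume *: "(w, \<top>\<^bsub>F\<^esub>) \<in> \<psi>" "(\<bottom>\<^bsub>F\<^esub>, c) \<in> \<psi>"
      show "Y c \<subseteq> \<psi>"
        unfolding Y_sub[OF c \<psi>]
        by (rule D_tri[OF t(1) sP[of "\<bottom>\<^bsub>F\<^esub>"] sP[OF cF] _ _ \<psi>])
           (use * Dt(1) cF pr[OF \<psi>] in \<open>auto simp: D_prin\<close>)
    next
      fix d assume d: "d \<in> X" and *: "Y c \<subseteq> \<psi>" "Y d \<subseteq> \<psi>"
      then have dF: "d \<in> carrier F" using XF by blast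
      have "D (s c) (s d) \<subseteq> \<psi>"
        by (rule D_tri[OF sP[OF cF] t(1) sP[OF dF] _ _ \<psi>])
           (use * Y_sub[OF c \<psi>] Y_sub[OF d \<psi>] D_sym[OF t(1) sP[OF cF]] in simp_all)
      then show "(c, d) \<in> \<psi>" using pr[OF \<psi>] cF dF by (simp add: D_prin)
    }
  qed
qed

theorem mainTheorem10:
  fixes E :: "(lat_term \<times> lat_term) set"
    and F :: "'a gorder"
    and X :: "'a set"
  assumes "nondistributive_variety TYPE('n) E"
    and "free_bounded_lattice E F X"
    and "cardSuc natLeq \<le>o |X|"
  shows "\<not> cpcp_retract TYPE('b) TYPE('t) (alg_natural (bl_algebra F :: ('e bl_symbol, 'a) alg)) \<and>
    (\<nexists>B :: ('e bl_symbol, 'a) alg. cpcp_extension (bl_algebra F) B)"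
proof -
  have "uncountable X" using assms(3) by (rule uncountable_if_cardSuc_natLeq_le)
  then show ?thesis
    using free_not_cpcp_retract[OF assms(2,1)] free_no_cpcp_extension[OF assms(2,1)] by blast
qed

end
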